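(* There is an algorithm which, given as input integers $r\ge 2$, $d\ge 2$, a word $w\in F(x_1,\dots,x_r)$ and a number $k\in\{1,\dots,r\}$, computes the standard group ring presentation of the Fox derivative $\partial w/\partial x_k$ in $\mathbb{Z}S_{r,d}$, in time $O(d\,r\,|w|^3)$. The algorithm is uniform in $r$ and $d$, and the constant in the bound does not depend on $r$, $d$, $k$ or $w$.
   Context: $F=F(x_1,\dots,x_r)$ is the free group of rank $r$; $F^{(1)}=[F,F]$, $F^{(d)}=[F^{(d-1)},F^{(d-1)}]$ for $d\ge 2$; $S_{r,d}=F/F^{(d)}$. The free Fox derivative $\partial/\partial x_k:\mathbb{Z}F\to\mathbb{Z}F$ is the unique additive map with $\partial x_j/\partial x_k=\delta_{jk}$ and $\partial(uv)/\partial x_k=(\partial u/\partial x_k)\,\varepsilon(v)+u\,\partial v/\partial x_k$, where $\varepsilon:\mathbb{Z}F\to\mathbb{Z}$ is the augmentation. The Fox derivative of $w$ in $\mathbb{Z}S_{r,d}$ is the image of $\partial w/\partial x_k$ under the ring homomorphism $\mathbb{Z}F\to\mathbb{Z}S_{r,d}$ induced by the canonical epimorphism $F\to S_{r,d}$. The standard group ring presentation of an element of $\mathbb{Z}S_{r,d}$ is its expression as a finite sum $\sum m_g g$ with integer coefficients $m_g$ and pairwise distinct $g\in S_{r,d}$ (like terms collected). For $\partial w/\partial x_k$ the group elements $g$ occurring are represented by initial segments of $w$. $|w|$ is the length of $w$. Time is the number of elementary steps, where operations on indices into $\{0,\dots,|w|\}$ (lookup, comparison) and on small integers are counted as single steps.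 *)

theory Defs
  imports "HOL-Algebra.Algebra"
begin

section \<open>Free groups and free solvable groups\<close>

text \<open>The letter \<open>(i, True)\<close> is the generator \<open>x\<^sub>i\<close> and \<open>(i, False)\<close> is its inverse.\<close>

type_synonym letter = "nat \<times> bool"

definition letters :: "nat \<Rightarrow> letter set" where
  "letters r = {1..r} \<times> UNIV"

definition inv_letter :: "letter \<Rightarrow> letter" where
  "inv_letter x = (fst x, \<not> snd x)"

fun reduced :: "letter list \<Rightarrow> bool" where
  "reduced [] = True"
| "reduced [x] = True"
| "reduced (x # y # u) = (y \<noteq> inv_letter x \<and> reduced (y # u))"

fun cancel_cons :: "letter \<Rightarrow> letter list \<Rightarrow> letter list" where
  "cancel_cons x [] = [x]"
| "cancel_cons x (y # u) = (if y = inv_letter x then u else x # y # u)"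

text \<open>\<open>reduce w\<close> is the reduced form of an arbitrary word \<open>w\<close>, that is, the element of the free
  group that \<open>w\<close> represents.\<close>

definition reduce :: "letter list \<Rightarrow> letter list" where
  "reduce w = foldr cancel_cons w []"

definition free_group :: "nat \<Rightarrow> letter list monoid" where
  "free_group r =
    \<lparr>carrier = {u. reduced u \<and> set u \<subseteq> letters r}, monoid.mult = (\<lambda>u v. reduce (u @ v)), one = []\<rparr>"

definition derived_term :: "nat \<Rightarrow> nat \<Rightarrow> letter list set" where
  "derived_term r d = (derived (free_group r) ^^ d) (carrier (free_group r))"

definition free_solvable_group :: "nat \<Rightarrow> nat \<Rightarrow> letter list set monoid" where
  "free_solvable_group r d = free_group r Mod derived_term r d"

definition solv_proj :: "nat \<Rightarrow> nat \<Rightarrow> letter list \<Rightarrow> letter list set" where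
  "solv_proj r d u = derived_term r d #>\<^bsub>free_group r\<^esub> u"


lemma inv_letter_simps [simp]:
  "inv_letter (inv_letter x) = x" "inv_letter x \<noteq> x" "x \<noteq> inv_letter x"
  by (auto simp: inv_letter_def prod_eq_iff)

lemma inv_letter_in_letters [simp]: "inv_letter x \<in> letters r \<longleftrightarrow> x \<in> letters r"
  by (auto simp: inv_letter_def letters_def mem_Times_iff)

lemma reduced_Cons_D: "reduced (x # u) \<Longrightarrow> reduced u"
  by (cases u) auto

lemma reduced_cancel_cons: "reduced u \<Longrightarrow> reduced (cancel_cons x u)"
  by (cases u) (auto dest: reduced_Cons_D)

lemma cancel_cons_inv: "reduced u \<Longrightarrow> cancel_cons x (cancel_cons (inv_letter x) u) = u"
proof (cases u)
  case (Cons y v)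
  assume "reduced u"
  then show ?thesis using Cons by (cases v) auto
qed auto

lemma cancel_cons_inv': "reduced u \<Longrightarrow> cancel_cons (inv_letter x) (cancel_cons x u) = u"
  using cancel_cons_inv[of u "inv_letter x"] by simp

lemma reduced_foldr: "reduced v \<Longrightarrow> reduced (foldr cancel_cons u v)"
  by (induction u) (auto simp: reduced_cancel_cons)

lemma reduced_reduce [simp]: "reduced (reduce w)"
  by (simp add: reduce_def reduced_foldr)

lemma reduce_reduced: "reduced u \<Longrightarrow> reduce u = u"
proof (induction u)
  case (Cons x u)
  then have "reduce u = u" by (auto dest: reduced_Cons_D)
  with Cons.prems show ?case by (cases u) (auto simp: reduce_def)
qed (simp add: reduce_def)

lemma foldr_cancel_cons:
  "reduced v \<Longrightarrow> foldr cancel_cons (cancel_cons x u) v = cancel_cons x (foldr cancel_cons u v)"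
  by (cases u) (auto simp: cancel_cons_inv reduced_foldr)

lemma foldr_reduce: "reduced v \<Longrightarrow> foldr cancel_cons (reduce u) v = foldr cancel_cons u v"
  by (induction u) (auto simp: reduce_def foldr_cancel_cons)

lemma reduce_append: "reduce (u @ v) = foldr cancel_cons u (reduce v)"
  by (simp add: reduce_def)

lemma reduce_append_left: "reduce (reduce u @ v) = reduce (u @ v)"
  by (simp add: reduce_append foldr_reduce)

lemma reduce_append_right: "reduce (u @ reduce v) = reduce (u @ v)"
  by (simp add: reduce_append reduce_reduced)

lemma set_cancel_cons: "set (cancel_cons x u) \<subseteq> insert x (set u)"
  by (cases u) auto

lemma set_reduce: "set (reduce u) \<subseteq> set u"
proof (induction u)
  case (Cons x u)
  then show ?case using set_cancel_cons[of x "reduce u"] by (auto simp: reduce_def)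
qed (simp add: reduce_def)

lemma reduce_inverse: "reduce (map inv_letter (rev u) @ u) = []"
proof (induction u)
  case (Cons x u)
  have "reduce (map inv_letter (rev (x # u)) @ x # u) =
      foldr cancel_cons (map inv_letter (rev u)) (cancel_cons (inv_letter x) (cancel_cons x (reduce u)))"
    by (simp add: reduce_def)
  also have "\<dots> = reduce (map inv_letter (rev u) @ u)"
    by (simp add: cancel_cons_inv' reduce_append)
  finally show ?case using Cons by simp
qed (simp add: reduce_def)

lemma reduce_in_carrier: "set w \<subseteq> letters r \<Longrightarrow> reduce w \<in> carrier (free_group r)"
  using set_reduce by (fastforce simp: free_group_def)

lemma group_free_group: "group (free_group r)"
proof (rule groupI)
  fix u v assume "u \<in> carrier (free_group r)" "v \<in> carrier (free_group r)"
  then show "u \<otimes>\<^bsub>free_group r\<^esub> v \<in> carrier (free_group r)"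
    using reduce_in_carrier[of "u @ v" r] by (simp add: free_group_def)
next
  fix u v w
  show "u \<otimes>\<^bsub>free_group r\<^esub> v \<otimes>\<^bsub>free_group r\<^esub> w = u \<otimes>\<^bsub>free_group r\<^esub> (v \<otimes>\<^bsub>free_group r\<^esub> w)"
    by (simp add: free_group_def reduce_append_left reduce_append_right)
next
  fix u assume u: "u \<in> carrier (free_group r)"
  then have "reduce (map inv_letter (rev u)) \<in> carrier (free_group r)"
    by (intro reduce_in_carrier) (auto simp: free_group_def)
  moreover have "reduce (map inv_letter (rev u)) \<otimes>\<^bsub>free_group r\<^esub> u = \<one>\<^bsub>free_group r\<^esub>"
    by (simp add: free_group_def reduce_append_left reduce_inverse)
  ultimately show "\<exists>v\<in>carrier (free_group r). v \<otimes>\<^bsub>free_group r\<^esub> u = \<one>\<^bsub>free_group r\<^esub>"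
    by blast
qed (auto simp: free_group_def reduce_reduced)

lemma normal_derived_term: "derived_term r d \<lhd> free_group r"
proof -
  interpret group "free_group r" by (rule group_free_group)
  show ?thesis
    by (induction d) (simp_all add: derived_term_def normal_self derived_is_normal)
qed

section \<open>Integral group rings\<close>

text \<open>Elements are the finitely supported functions from the group to the integers, extended by
  zero outside the carrier.\<close>

definition group_ring :: "('a, 'b) monoid_scheme \<Rightarrow> ('a \<Rightarrow> int) ring" where
  "group_ring G =
    \<lparr>carrier = {a. finite {g. a g \<noteq> 0} \<and> {g. a g \<noteq> 0} \<subseteq> carrier G},
     monoid.mult = (\<lambda>a b g. \<Sum>(h, h')\<in>{(h, h'). a h \<noteq> 0 \<and> b h' \<noteq> 0 \<and> h \<otimes>\<^bsub>G\<^esub> h' = g}. a h * b h'),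
     one = (\<lambda>g. if g = \<one>\<^bsub>G\<^esub> then 1 else 0),
     ring.zero = (\<lambda>g. 0),
     ring.add = (\<lambda>a b g. a g + b g)\<rparr>"

definition gr_basis :: "'a \<Rightarrow> 'a \<Rightarrow> int" where
  "gr_basis h = (\<lambda>g. if g = h then 1 else 0)"

definition gr_scale :: "int \<Rightarrow> ('a \<Rightarrow> int) \<Rightarrow> 'a \<Rightarrow> int" where
  "gr_scale m a = (\<lambda>g. m * a g)"

definition augmentation :: "('a \<Rightarrow> int) \<Rightarrow> int" where
  "augmentation a = (\<Sum>g | a g \<noteq> 0. a g)"

text \<open>The map of group rings induced by a group homomorphism \<open>\<phi>\<close>.\<close>

definition gr_map :: "('a \<Rightarrow> 'b) \<Rightarrow> ('a \<Rightarrow> int) \<Rightarrow> 'b \<Rightarrow> int" where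
  "gr_map \<phi> a = (\<lambda>y. \<Sum>x | a x \<noteq> 0 \<and> \<phi> x = y. a x)"

text \<open>Presentations are lists of terms \<open>(m, g)\<close>, read as the formal sum of the \<open>m g\<close>.\<close>

definition standard_presentation ::
  "('a, 'b) monoid_scheme \<Rightarrow> ('a \<Rightarrow> int) \<Rightarrow> (int \<times> 'a) list \<Rightarrow> bool" where
  "standard_presentation G a ps \<longleftrightarrow>
     (\<forall>(m, g)\<in>set ps. m \<noteq> 0 \<and> g \<in> carrier G) \<and>
     distinct (map snd ps) \<and>
     a = (\<lambda>x. \<Sum>(m, g)\<leftarrow>ps. gr_scale m (gr_basis g) x)"


section \<open>Fox derivatives\<close>

text \<open>The function space is the extensional one, so that the characterised map is unique as a
  function of the ambient type.\<close>

definition is_fox_derivative ::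
  "nat \<Rightarrow> nat \<Rightarrow> ((letter list \<Rightarrow> int) \<Rightarrow> (letter list \<Rightarrow> int)) \<Rightarrow> bool" where
  "is_fox_derivative r k D \<longleftrightarrow>
    (let R = group_ring (free_group r) in
       D \<in> carrier R \<rightarrow>\<^sub>E carrier R \<and>
       (\<forall>u\<in>carrier R. \<forall>v\<in>carrier R. D (u \<oplus>\<^bsub>R\<^esub> v) = D u \<oplus>\<^bsub>R\<^esub> D v) \<and>
       (\<forall>j\<in>{1..r}. D (gr_basis [(j, True)]) = (if j = k then \<one>\<^bsub>R\<^esub> else \<zero>\<^bsub>R\<^esub>)) \<and>
       (\<forall>u\<in>carrier R. \<forall>v\<in>carrier R.
          D (u \<otimes>\<^bsub>R\<^esub> v) = gr_scale (augmentation v) (D u) \<oplus>\<^bsub>R\<^esub> (u \<otimes>\<^bsub>R\<^esub> D v)))"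

definition fox_derivative ::
  "nat \<Rightarrow> nat \<Rightarrow> (letter list \<Rightarrow> int) \<Rightarrow> (letter list \<Rightarrow> int)" where
  "fox_derivative r k = (THE D. is_fox_derivative r k D)"

text \<open>Existence and uniqueness of the free Fox derivatives, so that the description in
  \<open>fox_derivative\<close> is proper. \<open>act u g\<close> is the reduced form of the inverse of \<open>u\<close> times \<open>g\<close>.\<close>

abbreviation act :: "letter list \<Rightarrow> letter list \<Rightarrow> letter list" where
  "act u g \<equiv> foldr cancel_cons (map inv_letter (rev u)) g"

fun word_fox :: "nat \<Rightarrow> letter list \<Rightarrow> letter list \<Rightarrow> int" where
  "word_fox k [] g = 0"
| "word_fox k (x # u) g =
    (if fst x = k then (if snd x then gr_basis [] g else - gr_basis [x] g) else 0) +
    word_fox k u (cancel_cons (inv_letter x) g)"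

lemma word_fox_append:
  "word_fox k (u @ v) g = word_fox k u g + word_fox k v (act u g)"
  by (induction u arbitrary: g) auto

lemma cancel_cons_eq_Nil: "reduced g \<Longrightarrow> cancel_cons x g = [] \<longleftrightarrow> g = [inv_letter x]"
  by (cases g) auto

lemma cancel_cons_eq_single: "reduced g \<Longrightarrow> cancel_cons x g = [x] \<longleftrightarrow> g = []"
  by (cases g) auto

lemma word_fox_cancel:
  assumes "reduced g"
  shows "word_fox k (x # inv_letter x # v) g = word_fox k v g"
proof -
  have 1: "snd (inv_letter x) = (\<not> snd x)" "fst (inv_letter x) = fst x"
    by (auto simp: inv_letter_def)
  show ?thesis
    using assms cancel_cons_eq_Nil[OF assms, of "inv_letter x"] cancel_cons_eq_single[OF assms, of "inv_letter x"]
    by (auto simp: 1 cancel_cons_inv gr_basis_def)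
qed

lemma word_fox_cancel_cons: "reduced g \<Longrightarrow> word_fox k (cancel_cons x u) g = word_fox k (x # u) g"
  using word_fox_cancel[of g k x] by (cases u) auto

lemma word_fox_reduce: "reduced g \<Longrightarrow> word_fox k (reduce u) g = word_fox k u g"
  by (induction u arbitrary: g) (auto simp: reduce_def word_fox_cancel_cons reduced_cancel_cons)

lemma act_eq:
  assumes "reduced u" "reduced g" "reduced y" shows "reduce (u @ y) = g \<longleftrightarrow> y = act u g"
proof -
  have "act u (foldr cancel_cons u y) = y" if "reduced y" for y u
    using that by (induction u arbitrary: y) (auto simp: cancel_cons_inv' reduced_foldr)
  moreover have "foldr cancel_cons u (act u y) = y" if "reduced y" for y u
    using that by (induction u arbitrary: y) (auto simp: cancel_cons_inv reduced_cancel_cons)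
  ultimately show ?thesis using assms by (auto simp: reduce_append reduce_reduced)
qed

lemma word_fox_support:
  "set u \<subseteq> letters r \<Longrightarrow> finite {g. reduced g \<and> word_fox k u g \<noteq> 0} \<and> {g. reduced g \<and> word_fox k u g \<noteq> 0} \<subseteq> {g. reduced g \<and> set g \<subseteq> letters r}"
proof (induction u)
  case (Cons x u)
  let ?S = "{g. reduced g \<and> word_fox k u g \<noteq> 0}"
  have sub: "{g. reduced g \<and> word_fox k (x # u) g \<noteq> 0} \<subseteq> {[], [x]} \<union> cancel_cons x ` ?S"
  proof
    fix g assume "g \<in> {g. reduced g \<and> word_fox k (x # u) g \<noteq> 0}"
    then have g: "reduced g" "word_fox k (x # u) g \<noteq> 0" by auto
    show "g \<in> {[], [x]} \<union> cancel_cons x ` ?S"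
    proof (cases "word_fox k u (cancel_cons (inv_letter x) g) = 0")
      case True
      then show ?thesis using g by (auto simp: gr_basis_def split: if_splits)
    next
      case False
      then have "cancel_cons (inv_letter x) g \<in> ?S" using g by (auto simp: reduced_cancel_cons)
      then have "cancel_cons x (cancel_cons (inv_letter x) g) \<in> cancel_cons x ` ?S"
        by (rule imageI)
      then show ?thesis unfolding cancel_cons_inv[OF g(1)] by (rule UnI2)
    qed
  qed
  have "{[], [x]} \<union> cancel_cons x ` ?S \<subseteq> {g. reduced g \<and> set g \<subseteq> letters r}"
  proof -
    have "reduced (cancel_cons x g) \<and> set (cancel_cons x g) \<subseteq> letters r" if "g \<in> ?S" for g
      using that Cons set_cancel_cons[of x g] by (auto simp: reduced_cancel_cons)
    then show ?thesis using Cons.prems by auto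
  qed
  moreover have "finite ({[], [x]} \<union> cancel_cons x ` ?S)" using Cons by auto
  ultimately show ?case using sub by (meson finite_subset subset_trans)
qed auto

definition explicit_fox :: "nat \<Rightarrow> (letter list \<Rightarrow> int) \<Rightarrow> (letter list \<Rightarrow> int)" where
  "explicit_fox k a = (\<lambda>g. if reduced g then \<Sum>u | a u \<noteq> 0. a u * word_fox k u g else 0)"

lemma gr_carrier: "a \<in> carrier (group_ring (free_group r)) \<longleftrightarrow> finite {g. a g \<noteq> 0} \<and> {g. a g \<noteq> 0} \<subseteq> {u. reduced u \<and> set u \<subseteq> letters r}"
  by (simp add: group_ring_def free_group_def)

lemma explicit_fox_carrier:
  assumes "a \<in> carrier (group_ring (free_group r))"
  shows "explicit_fox k a \<in> carrier (group_ring (free_group r))"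
proof -
  let ?U = "\<Union>u\<in>{u. a u \<noteq> 0}. {g. reduced g \<and> word_fox k u g \<noteq> 0}"
  have sub: "{g. explicit_fox k a g \<noteq> 0} \<subseteq> ?U"
  proof
    fix g assume "g \<in> {g. explicit_fox k a g \<noteq> 0}"
    then have "reduced g" "(\<Sum>u | a u \<noteq> 0. a u * word_fox k u g) \<noteq> 0"
      by (auto simp: explicit_fox_def split: if_splits)
    then obtain u where "a u \<noteq> 0" "a u * word_fox k u g \<noteq> 0"
      by (elim sum.not_neutral_contains_not_neutral) simp
    then show "g \<in> ?U" using \<open>reduced g\<close> by auto
  qed
  have "finite ?U" "?U \<subseteq> {u. reduced u \<and> set u \<subseteq> letters r}"
    using assms word_fox_support unfolding gr_carrier by (blast, blast)
  then show ?thesis unfolding gr_carrier using sub by (meson finite_subset subset_trans)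
qed

lemma sum_support:
  assumes "finite S" "{u. a u \<noteq> (0::int)} \<subseteq> S"
  shows "(\<Sum>u | a u \<noteq> 0. a u * f u) = (\<Sum>u\<in>S. a u * f u)"
  using assms by (intro sum.mono_neutral_left) auto

lemma explicit_fox_add:
  assumes "a \<in> carrier (group_ring (free_group r))" "b \<in> carrier (group_ring (free_group r))"
  shows "explicit_fox k (\<lambda>g. a g + b g) = (\<lambda>g. explicit_fox k a g + explicit_fox k b g)"
proof
  fix g
  let ?S = "{u. a u \<noteq> 0} \<union> {u. b u \<noteq> 0}"
  have f: "finite ?S" using assms by (auto simp: gr_carrier)
  have "(\<Sum>u | a u + b u \<noteq> 0. (a u + b u) * word_fox k u g) =
      (\<Sum>u | a u \<noteq> 0. a u * word_fox k u g) + (\<Sum>u | b u \<noteq> 0. b u * word_fox k u g)"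
  proof -
    have "(\<Sum>u | a u + b u \<noteq> 0. (a u + b u) * word_fox k u g) =
        (\<Sum>u\<in>?S. (a u + b u) * word_fox k u g)"
      by (rule sum_support[OF f]) auto
    moreover have "(\<Sum>u | a u \<noteq> 0. a u * word_fox k u g) = (\<Sum>u\<in>?S. a u * word_fox k u g)"
      by (rule sum_support[OF f]) auto
    moreover have "(\<Sum>u | b u \<noteq> 0. b u * word_fox k u g) = (\<Sum>u\<in>?S. b u * word_fox k u g)"
      by (rule sum_support[OF f]) auto
    ultimately show ?thesis by (simp only: distrib_right sum.distrib)
  qed
  then show "explicit_fox k (\<lambda>g. a g + b g) g = explicit_fox k a g + explicit_fox k b g"
    by (simp add: explicit_fox_def)
qed

lemma mult_sum:
  assumes "a \<in> carrier (group_ring (free_group r))" "b \<in> carrier (group_ring (free_group r))"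
  defines "c \<equiv> a \<otimes>\<^bsub>group_ring (free_group r)\<^esub> b"
  shows "(\<Sum>u | c u \<noteq> 0. c u * f u) = (\<Sum>h | a h \<noteq> 0. \<Sum>h' | b h' \<noteq> 0. a h * b h' * f (reduce (h @ h')))"
    and "c \<in> carrier (group_ring (free_group r))"
proof -
  let ?A = "{h. a h \<noteq> 0}" and ?B = "{h. b h \<noteq> 0}"
  let ?S = "(\<lambda>(h, h'). reduce (h @ h')) ` (?A \<times> ?B)"
  have fin: "finite ?A" "finite ?B" "finite ?S" using assms by (auto simp: gr_carrier)
  have c: "c g = (\<Sum>p | p \<in> ?A \<times> ?B \<and> (\<lambda>(h, h'). reduce (h @ h')) p = g. (case p of (h, h') \<Rightarrow> a h * b h'))" for g
    unfolding c_def group_ring_def free_group_def by (auto intro!: sum.cong)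
  have sub: "{u. c u \<noteq> 0} \<subseteq> ?S"
  proof
    fix u assume "u \<in> {u. c u \<noteq> 0}"
    then have "{p. p \<in> ?A \<times> ?B \<and> (\<lambda>(h, h'). reduce (h @ h')) p = u} \<noteq> {}"
      unfolding c by (metis (mono_tags, lifting) mem_Collect_eq sum.empty)
    then show "u \<in> ?S" by auto
  qed
  have "(\<Sum>u | c u \<noteq> 0. c u * f u) = (\<Sum>u\<in>?S. c u * f u)"
    by (rule sum_support[OF fin(3) sub])
  also have "\<dots> = (\<Sum>u\<in>?S. \<Sum>p | p \<in> ?A \<times> ?B \<and> (\<lambda>(h, h'). reduce (h @ h')) p = u. (case p of (h, h') \<Rightarrow> a h * b h' * f (reduce (h @ h'))))"
    unfolding c sum_distrib_right by (intro sum.cong refl) auto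
  also have "\<dots> = (\<Sum>p\<in>?A \<times> ?B. (case p of (h, h') \<Rightarrow> a h * b h' * f (reduce (h @ h'))))"
    using fin by (intro sum.group) auto
  also have "\<dots> = (\<Sum>h | a h \<noteq> 0. \<Sum>h' | b h' \<noteq> 0. a h * b h' * f (reduce (h @ h')))"
    by (simp add: sum.cartesian_product)
  finally show "(\<Sum>u | c u \<noteq> 0. c u * f u) = (\<Sum>h | a h \<noteq> 0. \<Sum>h' | b h' \<noteq> 0. a h * b h' * f (reduce (h @ h')))" .
  have "?S \<subseteq> {u. reduced u \<and> set u \<subseteq> letters r}"
  proof clarify
    fix h h' assume "a h \<noteq> 0" "b h' \<noteq> 0"
    then have "set (h @ h') \<subseteq> letters r" using assms by (auto simp: gr_carrier)
    then show "reduced (reduce (h @ h')) \<and> set (reduce (h @ h')) \<subseteq> letters r"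
      using set_reduce[of "h @ h'"] by auto
  qed
  then show "c \<in> carrier (group_ring (free_group r))"
    unfolding gr_carrier using sub fin by (meson finite_subset subset_trans)
qed

lemma gr_zero_outside: "a \<in> carrier (group_ring (free_group r)) \<Longrightarrow> \<not> reduced g \<Longrightarrow> a g = 0"
  by (auto simp: gr_carrier)

lemma mult_left:
  assumes "a \<in> carrier (group_ring (free_group r))" "b \<in> carrier (group_ring (free_group r))" "reduced g"
  shows "(a \<otimes>\<^bsub>group_ring (free_group r)\<^esub> b) g = (\<Sum>h | a h \<noteq> 0. a h * b (act h g))"
proof -
  have *: "{(h, h'). a h \<noteq> 0 \<and> b h' \<noteq> 0 \<and> reduce (h @ h') = g} =
      (\<lambda>h. (h, act h g)) ` {h. a h \<noteq> 0 \<and> b (act h g) \<noteq> 0}"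
  proof -
    have eq: "reduce (h @ h') = g \<longleftrightarrow> h' = act h g" if "a h \<noteq> 0" "b h' \<noteq> 0" for h h'
      using that assms by (intro act_eq) (auto intro: ccontr dest: gr_zero_outside)
    have "{(h, h'). a h \<noteq> 0 \<and> b h' \<noteq> 0 \<and> reduce (h @ h') = g} =
        {(h, h'). a h \<noteq> 0 \<and> b h' \<noteq> 0 \<and> h' = act h g}"
      using eq by blast
    then show ?thesis by auto
  qed
  have "(a \<otimes>\<^bsub>group_ring (free_group r)\<^esub> b) g = (\<Sum>(h, h')\<in>(\<lambda>h. (h, act h g)) ` {h. a h \<noteq> 0 \<and> b (act h g) \<noteq> 0}. a h * b h')"
    using * by (simp add: group_ring_def free_group_def)
  also have "\<dots> = (\<Sum>h | a h \<noteq> 0 \<and> b (act h g) \<noteq> 0. a h * b (act h g))"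
    by (subst sum.reindex) (auto simp: inj_on_def)
  also have "\<dots> = (\<Sum>h | a h \<noteq> 0. a h * b (act h g))"
    using assms by (intro sum.mono_neutral_left) (auto simp: gr_carrier)
  finally show ?thesis .
qed

lemma explicit_fox_mult:
  assumes a: "a \<in> carrier (group_ring (free_group r))" and b: "b \<in> carrier (group_ring (free_group r))"
  shows "explicit_fox k (a \<otimes>\<^bsub>group_ring (free_group r)\<^esub> b) =
    (\<lambda>g. augmentation b * explicit_fox k a g + (a \<otimes>\<^bsub>group_ring (free_group r)\<^esub> explicit_fox k b) g)"
    (is "_ = ?rhs")
proof
  fix g
  let ?R = "group_ring (free_group r)"
  show "explicit_fox k (a \<otimes>\<^bsub>?R\<^esub> b) g = ?rhs g"
  proof (cases "reduced g")
    case False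
    then show ?thesis
      using gr_zero_outside[OF mult_sum(2)[OF a explicit_fox_carrier[OF b]]]
      by (simp add: explicit_fox_def)
  next
    case g: True
    have red: "reduced (act h g)" for h using g by (simp add: reduced_foldr)
    have "explicit_fox k (a \<otimes>\<^bsub>?R\<^esub> b) g = (\<Sum>h | a h \<noteq> 0. \<Sum>h' | b h' \<noteq> 0. a h * b h' * word_fox k (reduce (h @ h')) g)"
      using g mult_sum(1)[OF a b] by (simp add: explicit_fox_def)
    also have "\<dots> = (\<Sum>h | a h \<noteq> 0. \<Sum>h' | b h' \<noteq> 0. a h * word_fox k h g * b h' + a h * (b h' * word_fox k h' (act h g)))"
      using g by (simp add: word_fox_reduce word_fox_append algebra_simps)
    also have "\<dots> = (\<Sum>h | a h \<noteq> 0. a h * word_fox k h g) * augmentation b + (\<Sum>h | a h \<noteq> 0. a h * explicit_fox k b (act h g))"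
      by (simp add: sum.distrib augmentation_def explicit_fox_def red
          flip: sum_distrib_left sum_distrib_right)
    finally show ?thesis
      using mult_left[OF a explicit_fox_carrier[OF b] g] g by (simp add: explicit_fox_def mult.commute)
  qed
qed

lemma gr_basis_carrier: "u \<in> carrier (free_group r) \<Longrightarrow> gr_basis u \<in> carrier (group_ring (free_group r))"
  by (auto simp: group_ring_def gr_basis_def)

lemma gr_basis_mult: "gr_basis u \<otimes>\<^bsub>group_ring (free_group r)\<^esub> gr_basis v = gr_basis (reduce (u @ v))"
proof
  fix g
  have "{(h, h'). (if h = u then 1 else 0) \<noteq> (0::int) \<and> (if h' = v then 1 else 0) \<noteq> (0::int) \<and> reduce (h @ h') = g} = (if reduce (u @ v) = g then {(u, v)} else {})"
    by (auto split: if_splits)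
  then show "(gr_basis u \<otimes>\<^bsub>group_ring (free_group r)\<^esub> gr_basis v) g = gr_basis (reduce (u @ v)) g"
    by (auto simp: group_ring_def free_group_def gr_basis_def)
qed

lemma augmentation_basis: "augmentation (gr_basis u) = 1"
proof -
  have "{g. gr_basis u g \<noteq> 0} = {u}" by (auto simp: gr_basis_def)
  then show ?thesis by (simp add: augmentation_def gr_basis_def)
qed

lemma fox_exists:
  "is_fox_derivative r k (restrict (explicit_fox k) (carrier (group_ring (free_group r))))"
proof -
  let ?R = "group_ring (free_group r)"
  have add: "u \<oplus>\<^bsub>?R\<^esub> v = (\<lambda>g. u g + v g)" for u v by (simp add: group_ring_def)
  have addc: "u \<oplus>\<^bsub>?R\<^esub> v \<in> carrier ?R" if "u \<in> carrier ?R" "v \<in> carrier ?R" for u v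
  proof -
    have "{g. u g + v g \<noteq> 0} \<subseteq> {g. u g \<noteq> 0} \<union> {g. v g \<noteq> 0}" by auto
    then show ?thesis using that unfolding add gr_carrier by (meson finite_Un finite_subset le_sup_iff subset_trans)
  qed
  have gens: "explicit_fox k (gr_basis [(j, True)]) = (if j = k then \<one>\<^bsub>?R\<^esub> else \<zero>\<^bsub>?R\<^esub>)" for j
  proof
    fix g
    have set: "{u. gr_basis [(j, True)] u \<noteq> 0} = {[(j, True)]}" by (auto simp: gr_basis_def)
    have "(\<Sum>u | gr_basis [(j, True)] u \<noteq> 0. gr_basis [(j, True)] u * word_fox k u g) =
        word_fox k [(j, True)] g"
      unfolding set by (simp add: gr_basis_def)
    also have "\<dots> = (if j = k then gr_basis [] g else 0)" by simp
    finally have "explicit_fox k (gr_basis [(j, True)]) g =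
        (if reduced g then if j = k then gr_basis [] g else 0 else 0)"
      by (simp only: explicit_fox_def)
    also have "\<dots> = (if j = k then \<one>\<^bsub>?R\<^esub> else \<zero>\<^bsub>?R\<^esub>) g"
      by (cases "g = []") (simp_all add: group_ring_def free_group_def gr_basis_def)
    finally show "explicit_fox k (gr_basis [(j, True)]) g =
        (if j = k then \<one>\<^bsub>?R\<^esub> else \<zero>\<^bsub>?R\<^esub>) g" .
  qed
  let ?D = "restrict (explicit_fox k) (carrier ?R)"
  have D: "?D u = explicit_fox k u" if "u \<in> carrier ?R" for u
    using that by simp
  show ?thesis
    unfolding is_fox_derivative_def Let_def
  proof (intro conjI ballI)
    show "?D \<in> carrier ?R \<rightarrow>\<^sub>E carrier ?R"
      using explicit_fox_carrier by (intro restrict_PiE_iff[THEN iffD2]) blast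
  next
    fix u v assume u: "u \<in> carrier ?R" and v: "v \<in> carrier ?R"
    show "?D (u \<oplus>\<^bsub>?R\<^esub> v) = ?D u \<oplus>\<^bsub>?R\<^esub> ?D v"
      unfolding D[OF addc[OF u v]] D[OF u] D[OF v] unfolding add by (rule explicit_fox_add[OF u v])
    show "?D (u \<otimes>\<^bsub>?R\<^esub> v) =
        gr_scale (augmentation v) (?D u) \<oplus>\<^bsub>?R\<^esub> (u \<otimes>\<^bsub>?R\<^esub> ?D v)"
      unfolding D[OF mult_sum(2)[OF u v]] D[OF u] D[OF v] add gr_scale_def
      by (rule explicit_fox_mult[OF u v])
  next
    fix j assume "j \<in> {1..r}"
    then have "[(j, True)] \<in> carrier (free_group r)" by (simp add: free_group_def letters_def)
    then show "?D (gr_basis [(j, True)]) = (if j = k then \<one>\<^bsub>?R\<^esub> else \<zero>\<^bsub>?R\<^esub>)"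
      using D[OF gr_basis_carrier] gens by simp
  qed
qed

lemma fox_unique:
  assumes D: "is_fox_derivative r k D" and E: "is_fox_derivative r k E"
  shows "D = E"
proof -
  let ?R = "group_ring (free_group r)"
  have add: "u \<oplus>\<^bsub>?R\<^esub> v = (\<lambda>g. u g + v g)" for u v by (simp add: group_ring_def)
  have mem: "F u \<in> carrier ?R" and
       Dadd: "u \<in> carrier ?R \<Longrightarrow> v \<in> carrier ?R \<Longrightarrow> F (\<lambda>g. u g + v g) = (\<lambda>g. F u g + F v g)" and
       Dgen: "j \<in> {1..r} \<Longrightarrow> F (gr_basis [(j, True)]) = (if j = k then \<one>\<^bsub>?R\<^esub> else \<zero>\<^bsub>?R\<^esub>)" and
       Dmult: "u \<in> carrier ?R \<Longrightarrow> v \<in> carrier ?R \<Longrightarrow> F (u \<otimes>\<^bsub>?R\<^esub> v) = (\<lambda>g. augmentation v * F u g + (u \<otimes>\<^bsub>?R\<^esub> F v) g)"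
    if "is_fox_derivative r k F" "u \<in> carrier ?R" for F u v j
    using that unfolding is_fox_derivative_def Let_def add gr_scale_def by auto
  have zc: "(\<lambda>g. 0) \<in> carrier ?R" by (simp add: gr_carrier)
  have F0: "F (\<lambda>g. 0) = (\<lambda>g. 0)" if "is_fox_derivative r k F" for F
    using Dadd[OF that zc zc zc] by (metis add_cancel_left_left ext)
  have nc: "[] \<in> carrier (free_group r)" by (simp add: free_group_def)
  have Db: "F (gr_basis (reduce (u @ v))) = (\<lambda>g. F (gr_basis u) g + (gr_basis u \<otimes>\<^bsub>?R\<^esub> F (gr_basis v)) g)"
    if "is_fox_derivative r k F" "u \<in> carrier (free_group r)" "v \<in> carrier (free_group r)" for F u v
    using Dmult[OF that(1) gr_basis_carrier[OF that(2)] gr_basis_carrier[OF that(2)] gr_basis_carrier[OF that(3)]]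
    by (simp add: gr_basis_mult augmentation_basis)
  have left: "(gr_basis u \<otimes>\<^bsub>?R\<^esub> b) g = b (act u g)" if "u \<in> carrier (free_group r)" "b \<in> carrier ?R" "reduced g" for u b g
  proof -
    have "{h. gr_basis u h \<noteq> 0} = {u}" by (auto simp: gr_basis_def)
    then show ?thesis using mult_left[OF gr_basis_carrier[OF that(1)] that(2,3)] by (simp add: gr_basis_def)
  qed
  have F1: "F (gr_basis []) = (\<lambda>g. 0)" if F: "is_fox_derivative r k F" for F
  proof
    fix g
    have c: "F (gr_basis []) \<in> carrier ?R" using mem[OF F gr_basis_carrier[OF nc]] .
    show "F (gr_basis []) g = 0"
    proof (cases "reduced g")
      case True
      then show ?thesis using fun_cong[OF Db[OF F nc nc], of g] left[OF nc c True] by (simp add: reduce_def)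
    qed (use gr_zero_outside[OF c] in auto)
  qed
  have lc: "[x] \<in> carrier (free_group r)" if "x \<in> letters r" for x using that by (simp add: free_group_def)
  have letter: "D (gr_basis [x]) = E (gr_basis [x])" if x: "x \<in> letters r" for x
  proof (cases "snd x")
    case True
    then obtain j where "x = (j, True)" "j \<in> {1..r}" using x by (cases x) (auto simp: letters_def)
    then show ?thesis using Dgen[OF D zc] Dgen[OF E zc] by simp
  next
    case False
    then obtain j where j: "x = (j, False)" "j \<in> {1..r}" using x by (cases x) (auto simp: letters_def)
    let ?y = "(j, True)"
    have y: "[?y] \<in> carrier (free_group r)" using j by (intro lc) (auto simp: letters_def)
    have eq: "D (gr_basis [?y]) = E (gr_basis [?y])" using j Dgen[OF D zc] Dgen[OF E zc] by simp
    have red: "reduce ([x] @ [?y]) = []" using j by (simp add: reduce_def inv_letter_def)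
    have neg: "F (gr_basis [x]) g = - (gr_basis [x] \<otimes>\<^bsub>?R\<^esub> F (gr_basis [?y])) g" if F: "is_fox_derivative r k F" for F g
      using fun_cong[OF Db[OF F lc[OF x] y], of g] unfolding red F1[OF F] by linarith
    show ?thesis by (rule ext) (simp only: neg[OF D] neg[OF E] eq)
  qed
  have word: "D (gr_basis u) = E (gr_basis u)" if "u \<in> carrier (free_group r)" for u
    using that
  proof (induction u)
    case Nil then show ?case using F1[OF D] F1[OF E] by simp
  next
    case (Cons x u)
    have u: "u \<in> carrier (free_group r)" and x: "x \<in> letters r"
      using Cons.prems by (simp_all add: free_group_def reduced_Cons_D[of x u])
    have red: "reduce ([x] @ u) = x # u" using Cons.prems reduce_reduced[of "x # u"] by (simp add: free_group_def)
    show ?case using Db[OF D lc[OF x] u] Db[OF E lc[OF x] u] letter[OF x] Cons.IH[OF u] by (simp only: red)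
  qed
  have int_scale: "D (\<lambda>g. m * gr_basis u g) = E (\<lambda>g. m * gr_basis u g) \<and> (\<lambda>g. m * gr_basis u g) \<in> carrier ?R"
    if u: "u \<in> carrier (free_group r)" for u and m :: int
  proof -
    have c: "(\<lambda>g. m * gr_basis u g) \<in> carrier ?R" for m
      using u by (auto simp: group_ring_def gr_basis_def)
    have "F (\<lambda>g. m * gr_basis u g) = (\<lambda>g. m * F (gr_basis u) g)" if F: "is_fox_derivative r k F" for F
    proof (induction m rule: int_induct[where k = 0])
      case base then show ?case using F0[OF F] by simp
    next
      case (step1 i)
      show ?case using Dadd[OF F c[of i] c[of i] gr_basis_carrier[OF u]] step1 by (simp add: distrib_right)
    next
      case (step2 i)
      show ?case using Dadd[OF F c[of "i - 1"] c[of "i - 1"] gr_basis_carrier[OF u]] step2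
        by (auto simp: left_diff_distrib fun_eq_iff)
    qed
    then show ?thesis using D E word[OF u] c by auto
  qed
  have all: "D a = E a" if "finite S" "a \<in> carrier ?R" "{g. a g \<noteq> 0} \<subseteq> S" "S \<subseteq> carrier (free_group r)" for a S
    using that
  proof (induction S arbitrary: a)
    case empty
    then have "a = (\<lambda>g. 0)" by auto
    then show ?case using F0[OF D] F0[OF E] by simp
  next
    case (insert x S)
    let ?b = "a(x := 0)"
    have x: "x \<in> carrier (free_group r)" using insert by auto
    have b: "?b \<in> carrier ?R"
    proof -
      have "{g. ?b g \<noteq> 0} \<subseteq> {g. a g \<noteq> 0}" by auto
      then show ?thesis using insert.prems(1) unfolding gr_carrier by (meson finite_subset subset_trans)
    qed
    have a: "a = (\<lambda>g. ?b g + a x * gr_basis x g)" by (auto simp: gr_basis_def)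
    have "{g. ?b g \<noteq> 0} \<subseteq> S" using insert.prems by auto
    then have eq: "D ?b = E ?b" by (intro insert.IH[OF b]) (use insert.prems in auto)
    have sum: "F a = (\<lambda>g. F ?b g + F (\<lambda>g. a x * gr_basis x g) g)"
      if F: "is_fox_derivative r k F" for F
      by (rule trans[OF arg_cong[where f = F, OF a] Dadd[OF F b b int_scale[OF x, THEN conjunct2]]])
    show ?case
      unfolding sum[OF D] sum[OF E] eq int_scale[OF x, of "a x", THEN conjunct1] by (rule refl)
  qed
  have "D a = E a" for a
  proof (cases "a \<in> carrier ?R")
    case True
    then show ?thesis using all[of "{g. a g \<noteq> 0}" a] by (auto simp: group_ring_def)
  next
    case False
    then show ?thesis using D E unfolding is_fox_derivative_def Let_def PiE_def extensional_def by auto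
  qed
  then show ?thesis by blast
qed

lemma ex1_fox_derivative: "\<exists>!D. is_fox_derivative r k D"
  using fox_exists fox_unique by blast

lemma is_fox_derivative_fox_derivative: "is_fox_derivative r k (fox_derivative r k)"
  unfolding fox_derivative_def by (rule theI'[OF ex1_fox_derivative])

definition solvable_fox_derivative ::
  "nat \<Rightarrow> nat \<Rightarrow> nat \<Rightarrow> letter list \<Rightarrow> letter list set \<Rightarrow> int" where
  "solvable_fox_derivative r d k w =
    gr_map (solv_proj r d) (fox_derivative r k (gr_basis (reduce w)))"


section \<open>Programs and running time\<close>

text \<open>A successor random access machine in structured form. The store consists of integer
  registers and of integer arrays. Registers and arrays are named by numbers that are fixed in the
  program text; only the index of an array access is computed at run time. The sole arithmetic
  operations are increment and decrement, so that no integer in the store ever exceeds, in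
  absolute value, the largest initial entry or program literal by more than the number of steps (lemma \<open>exec_small\<close> below), and charging a
  single step per operation is not an abuse of the unit-cost measure.\<close>

record store =
  reg :: "nat \<Rightarrow> int"
  arr :: "nat \<Rightarrow> int \<Rightarrow> int"

datatype test = Equal nat nat | Less nat nat

datatype com =
    Nop
  | Const nat int
  | Copy nat nat
  | Incr nat
  | Decr nat
  | Load nat nat nat
  | Store nat nat nat
  | Seq com com
  | Cond test com com
  | While test com

fun holds :: "test \<Rightarrow> store \<Rightarrow> bool" where
  "holds (Equal x y) s = (reg s x = reg s y)"
| "holds (Less x y) s = (reg s x < reg s y)"

definition set_reg :: "nat \<Rightarrow> int \<Rightarrow> store \<Rightarrow> store" where
  "set_reg x v s = s\<lparr>reg := (reg s)(x := v)\<rparr>"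

definition set_arr :: "nat \<Rightarrow> int \<Rightarrow> int \<Rightarrow> store \<Rightarrow> store" where
  "set_arr a i v s = s\<lparr>arr := (arr s)(a := (arr s a)(i := v))\<rparr>"

text \<open>\<open>exec c s t s'\<close>: started in store \<open>s\<close>, program \<open>c\<close> halts after \<open>t\<close> elementary steps in
  store \<open>s'\<close>. Every primitive command and every evaluation of a test is one step.\<close>

inductive exec :: "com \<Rightarrow> store \<Rightarrow> nat \<Rightarrow> store \<Rightarrow> bool" where
  Nop: "exec Nop s 1 s"
| Const: "exec (Const x n) s 1 (set_reg x n s)"
| Copy: "exec (Copy x y) s 1 (set_reg x (reg s y) s)"
| Incr: "exec (Incr x) s 1 (set_reg x (reg s x + 1) s)"
| Decr: "exec (Decr x) s 1 (set_reg x (reg s x - 1) s)"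
| Load: "exec (Load x a i) s 1 (set_reg x (arr s a (reg s i)) s)"
| Store: "exec (Store a i x) s 1 (set_arr a (reg s i) (reg s x) s)"
| Seq: "exec c1 s t1 s' \<Longrightarrow> exec c2 s' t2 s'' \<Longrightarrow> exec (Seq c1 c2) s (t1 + t2) s''"
| CondT: "holds b s \<Longrightarrow> exec c1 s t s' \<Longrightarrow> exec (Cond b c1 c2) s (1 + t) s'"
| CondF: "\<not> holds b s \<Longrightarrow> exec c2 s t s' \<Longrightarrow> exec (Cond b c1 c2) s (1 + t) s'"
| WhileF: "\<not> holds b s \<Longrightarrow> exec (While b c) s 1 s"
| WhileT: "holds b s \<Longrightarrow> exec c s t1 s' \<Longrightarrow> exec (While b c) s' t2 s'' \<Longrightarrow>
    exec (While b c) s (1 + t1 + t2) s''"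

lemma exec_deterministic:
  "exec c s t s' \<Longrightarrow> exec c s u s'' \<Longrightarrow> u = t \<and> s'' = s'"
proof (induction arbitrary: u s'' rule: exec.induct)
  case (Seq c1 s t1 s1 c2 t2 s2)
  from Seq.prems show ?case by cases (use Seq.IH in blast)
next
  case (CondT b s c1 t s' c2)
  from CondT.prems show ?case by cases (use CondT in blast)+
next
  case (CondF b s c2 t s' c1)
  from CondF.prems show ?case by cases (use CondF in blast)+
next
  case (WhileF b s c)
  from WhileF.prems show ?case by cases (use WhileF in auto)
next
  case (WhileT b s c t1 s1 t2 s2)
  from WhileT.prems show ?case by cases (use WhileT in blast)+
qed (erule exec.cases; simp)+

fun literals :: "com \<Rightarrow> int set" where
  "literals (Const x n) = {n}"
| "literals (Seq c1 c2) = literals c1 \<union> literals c2"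
| "literals (Cond b c1 c2) = literals c1 \<union> literals c2"
| "literals (While b c) = literals c"
| "literals _ = {}"

definition store_bound :: "int \<Rightarrow> store \<Rightarrow> bool" where
  "store_bound B s \<longleftrightarrow> (\<forall>x. \<bar>reg s x\<bar> \<le> B) \<and> (\<forall>a i. \<bar>arr s a i\<bar> \<le> B)"

lemma store_bound_mono: "store_bound B s \<Longrightarrow> B \<le> B' \<Longrightarrow> store_bound B' s"
  unfolding store_bound_def by (meson order_trans)

lemma store_bound_set_reg: "store_bound B s \<Longrightarrow> \<bar>v\<bar> \<le> B \<Longrightarrow> store_bound B (set_reg x v s)"
  by (simp add: store_bound_def set_reg_def)

lemma store_bound_set_arr: "store_bound B s \<Longrightarrow> \<bar>v\<bar> \<le> B \<Longrightarrow> store_bound B (set_arr a i v s)"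
  by (simp add: store_bound_def set_arr_def)

lemma exec_small:
  "exec c s t s' \<Longrightarrow> (\<forall>n\<in>literals c. \<bar>n\<bar> \<le> B) \<Longrightarrow> store_bound B s \<Longrightarrow> store_bound (B + int t) s'"
proof (induction arbitrary: B rule: exec.induct)
  case (Nop s)
  then show ?case by (auto elim: store_bound_mono)
next
  case (Const x n s)
  then have "store_bound B (set_reg x n s)" by (simp add: store_bound_set_reg)
  then show ?case by (rule store_bound_mono) simp
next
  case (Copy x y s)
  then have "store_bound B (set_reg x (reg s y) s)"
    by (intro store_bound_set_reg) (simp_all add: store_bound_def)
  then show ?case by (rule store_bound_mono) simp
next
  case (Incr x s)
  then have "\<bar>reg s x\<bar> \<le> B" by (simp add: store_bound_def)
  moreover have "store_bound (B + 1) s" using Incr(2) by (rule store_bound_mono) simp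
  ultimately show ?case by (simp add: store_bound_set_reg)
next
  case (Decr x s)
  then have "\<bar>reg s x\<bar> \<le> B" by (simp add: store_bound_def)
  moreover have "store_bound (B + 1) s" using Decr(2) by (rule store_bound_mono) simp
  ultimately show ?case by (simp add: store_bound_set_reg)
next
  case (Load x a i s)
  then have "store_bound B (set_reg x (arr s a (reg s i)) s)"
    by (intro store_bound_set_reg) (simp_all add: store_bound_def)
  then show ?case by (rule store_bound_mono) simp
next
  case (Store a i x s)
  then have "store_bound B (set_arr a (reg s i) (reg s x) s)"
    by (intro store_bound_set_arr) (simp_all add: store_bound_def)
  then show ?case by (rule store_bound_mono) simp
next
  case (Seq c1 s t1 s1 c2 t2 s2)
  have lit: "\<forall>n\<in>literals c1. \<bar>n\<bar> \<le> B" "\<forall>n\<in>literals c2. \<bar>n\<bar> \<le> B + int t1"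
    using Seq.prems(1) by (auto intro: order_trans[of _ B])
  have "store_bound (B + int t1 + int t2) s2"
    by (rule Seq.IH(2)[OF lit(2) Seq.IH(1)[OF lit(1) Seq.prems(2)]])
  then show ?case by (rule store_bound_mono) simp
next
  case (CondT b s c1 t s' c2)
  have "store_bound (B + int t) s'" by (rule CondT.IH) (use CondT.prems in simp_all)
  then show ?case by (rule store_bound_mono) simp
next
  case (CondF b s c2 t s' c1)
  have "store_bound (B + int t) s'" by (rule CondF.IH) (use CondF.prems in simp_all)
  then show ?case by (rule store_bound_mono) simp
next
  case (WhileF b s c)
  then show ?case by (auto elim: store_bound_mono)
next
  case (WhileT b s c t1 s1 t2 s2)
  have lit: "\<forall>n\<in>literals c. \<bar>n\<bar> \<le> B" "\<forall>n\<in>literals (While b c). \<bar>n\<bar> \<le> B + int t1"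
    using WhileT.prems(1) by (auto intro: order_trans[of _ B])
  have "store_bound (B + int t1 + int t2) s2"
    by (rule WhileT.IH(2)[OF lit(2) WhileT.IH(1)[OF lit(1) WhileT.prems(2)]])
  then show ?case by (rule store_bound_mono) simp
qed

text \<open>The input convention: \<open>r\<close>, \<open>d\<close>, \<open>k\<close> and the length of \<open>w\<close> are in registers 0, 1, 2, 3; the
  generator indices of the letters of \<open>w\<close> are in array 0 and their exponents (1 or -1) in array 1.
  The output convention: the number of terms is in register 0, the coefficients are in array 2,
  and array 3 holds, for each term, the length of an initial segment of \<open>w\<close> that represents the
  group element of that term.\<close>

definition input_store :: "nat \<Rightarrow> nat \<Rightarrow> nat \<Rightarrow> letter list \<Rightarrow> store" where
  "input_store r d k w =
    \<lparr>reg = (\<lambda>_. 0)(0 := int r, 1 := int d, 2 := int k, 3 := int (length w)),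
     arr = (\<lambda>_ _. 0)
       (0 := (\<lambda>i. if 0 \<le> i \<and> i < int (length w) then int (fst (w ! nat i)) else 0),
        1 := (\<lambda>i. if 0 \<le> i \<and> i < int (length w) then (if snd (w ! nat i) then 1 else -1) else 0))\<rparr>"

definition output_is :: "store \<Rightarrow> (int \<times> nat) list \<Rightarrow> bool" where
  "output_is s ps \<longleftrightarrow>
     reg s 0 = int (length ps) \<and>
     (\<forall>j < length ps. arr s 2 (int j) = fst (ps ! j) \<and> arr s 3 (int j) = int (snd (ps ! j)))"

definition output_presents_fox :: "nat \<Rightarrow> nat \<Rightarrow> nat \<Rightarrow> letter list \<Rightarrow> store \<Rightarrow> bool" where
  "output_presents_fox r d k w s \<longleftrightarrow>
     (\<exists>ps. output_is s ps \<and>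
        (\<forall>(m, i)\<in>set ps. i \<le> length w) \<and>
        standard_presentation (free_solvable_group r d) (solvable_fox_derivative r d k w)
          (map (\<lambda>(m, i). (m, solv_proj r d (reduce (take i w)))) ps))"

end

theory Submission
  imports Defs
begin

text \<open>Let \<open>N\<close> be normal in the free group \<open>F\<close> and read a word \<open>w\<close> as a path in the Cayley graph of
  \<open>F/N\<close>. Two prefixes of \<open>w\<close> agree modulo \<open>[N, N]\<close> iff the piece of the path between them has zero
  flow through every edge: the flow is additive on \<open>N\<close>, hence vanishes on commutators, and
  conversely, after the choice of a transversal, an element of \<open>N\<close> is modulo \<open>[N, N]\<close> a product of
  one factor per edge, raised to the flow through that edge. With \<open>N = F\<^sup>(\<^sup>m\<^sup>)\<close> this turns a
  labelling of the prefixes by their classes modulo \<open>F\<^sup>(\<^sup>m\<^sup>)\<close> into one modulo \<open>F\<^sup>(\<^sup>m\<^sup>+\<^sup>1\<^sup>)\<close>; for a fixed left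
  end the flow is updated letter by letter, together with the number of edges that carry nonzero
  flow, so that a level costs \<open>O(|w|\<^sup>2)\<close> steps. Finally \<open>\<partial>w/\<partial>x\<^sub>k\<close> is the sum of the signed
  starting vertices of the edges labelled \<open>x\<^sub>k\<close>, and the labels tell which terms to collect.\<close>

section \<open>Flows and the derived subgroup\<close>

text \<open>Commutativity lets the factors be collected edge by edge: \<open>b l\<close> is
  \<open>b i\<close> times the product of all \<open>c x\<close> raised to the flow through
  \<open>x\<close> between \<open>i\<close> and \<open>l\<close>. Zero flow makes every exponent
  vanish.\<close>

lemma (in comm_group) telescoping_path_product:
  fixes b :: "nat \<Rightarrow> 'a" and c :: "'e \<Rightarrow> 'a" and e :: "nat \<Rightarrow> 'e" and s :: "nat \<Rightarrow> int"
  assumes b: "\<And>p. b p \<in> carrier G" and c: "\<And>x. c x \<in> carrier G"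
    and b_Suc: "\<And>p. i \<le> p \<Longrightarrow> p < j \<Longrightarrow> b (Suc p) = b p \<otimes> c (e p) [^] s p"
    and "i \<le> j" and zero: "\<And>x. (\<Sum>p\<in>{i..<j}. if e p = x then s p else 0) = 0"
  shows "b j = b i"
proof -
  let ?E = "e ` {i..<j}"
  let ?flow = "\<lambda>l x. \<Sum>p\<in>{i..<l}. if e p = x then s p else 0"
  \<comment> \<open>The product ranges over the edges of the whole path, so that its index set stays
    fixed while \<open>l\<close> grows.\<close>
  have "b l = b i \<otimes> (\<Otimes>x\<in>?E. c x [^] ?flow l x)" if "i \<le> l" "l \<le> j" for l
    using that
  proof (induction l rule: dec_induct)
    case base
    then show ?case using b by simp
  next
    case (step l)
    have "(\<Otimes>x\<in>?E. c x [^] ?flow (Suc l) x) =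
        (\<Otimes>x\<in>?E. c x [^] ?flow l x \<otimes> (if e l = x then c x [^] s l else \<one>))"
      using c step.hyps by (intro finprod_cong') (auto simp: int_pow_mult)
    also have "\<dots> = (\<Otimes>x\<in>?E. c x [^] ?flow l x) \<otimes> (\<Otimes>x\<in>?E. if e l = x then c x [^] s l else \<one>)"
      using c by (intro finprod_multf) auto
    also have "(\<Otimes>x\<in>?E. if e l = x then c x [^] s l else \<one>) = c (e l) [^] s l"
      using c step by (intro finprod_singleton) auto
    finally show ?case
      using step b_Suc[of l] b c by (simp add: m_assoc)
  qed
  from this[OF \<open>i \<le> j\<close> order_refl] show ?thesis by (simp only: zero) (simp add: b)
qed

text \<open>The additive counterpart: grouping the steps by edge gives \<open>g x\<close> times the
  flow through \<open>x\<close>. It serves below to compare cosets by means of an indicator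
  function.\<close>

lemma telescoping_path_sum:
  fixes f :: "nat \<Rightarrow> int" and g :: "'e \<Rightarrow> int"
  assumes step: "\<And>p. i \<le> p \<Longrightarrow> p < j \<Longrightarrow> f (Suc p) = f p + s p * g (e p)"
    and "i \<le> j" and zero: "\<And>x. (\<Sum>p\<in>{i..<j}. if e p = x then s p else 0) = 0"
  shows "f j = f i"
proof -
  have "f l = f i + (\<Sum>p\<in>{i..<l}. s p * g (e p))" if "i \<le> l" "l \<le> j" for l
    using that by (induction l rule: dec_induct) (simp_all add: step)
  then have "f j = f i + (\<Sum>p\<in>{i..<j}. s p * g (e p))" using \<open>i \<le> j\<close> by blast
  also have "(\<Sum>p\<in>{i..<j}. s p * g (e p)) =
      (\<Sum>x\<in>e ` {i..<j}. \<Sum>p | p \<in> {i..<j} \<and> e p = x. s p * g (e p))"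
    by (rule sum.group[symmetric]) auto
  also have "\<dots> = 0"
  proof (rule sum.neutral, rule ballI)
    fix x
    have "(\<Sum>p | p \<in> {i..<j} \<and> e p = x. s p * g (e p)) = (\<Sum>p | p \<in> {i..<j} \<and> e p = x. s p) * g x"
      by (simp add: sum_distrib_right)
    also have "(\<Sum>p | p \<in> {i..<j} \<and> e p = x. s p) = (\<Sum>p\<in>{i..<j}. if e p = x then s p else 0)"
      by (rule sum.inter_filter) simp
    finally show "(\<Sum>p | p \<in> {i..<j} \<and> e p = x. s p * g (e p)) = 0" by (simp only: zero mult_zero_left)
  qed
  finally show ?thesis by simp
qed

lemma (in normal) coset_eq_mult_right:
  assumes "x \<in> carrier G" "y \<in> carrier G" "z \<in> carrier G" "H #> x = H #> y"
  shows "H #> (x \<otimes> z) = H #> (y \<otimes> z)"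
  using assms by (metis coset_mult_assoc subset)

lemma (in normal) coset_eq_iff:
  assumes "x \<in> carrier G" "y \<in> carrier G"
  shows "H #> x = H #> y \<longleftrightarrow> x \<otimes> inv y \<in> H"
proof
  assume "H #> x = H #> y"
  then have "x \<in> H #> y" using rcos_self[OF assms(1) is_subgroup] by simp
  then show "x \<otimes> inv y \<in> H" using rcos_module_imp[OF is_group] assms by blast
next
  assume "x \<otimes> inv y \<in> H"
  then have "x \<in> H #> y" using rcos_module_rev[OF is_group] assms by blast
  then show "H #> x = H #> y" using repr_independence[OF _ assms(2) is_subgroup] by simp
qed

text \<open>Dividing \<open>a p\<close> by the chosen representative of its coset gives
  \<open>b p\<close> in \<open>H\<close>. A step of the path multiplies \<open>b p\<close> by a
  factor in \<open>H\<close> that depends only on the edge, or divides by it. In the abelianization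
  of \<open>H\<close> zero flow makes these factors cancel, and since both ends lie in one coset of
  \<open>H\<close>, the same representative leads back to \<open>a i\<close> and
  \<open>a j\<close>.\<close>

lemma (in normal) zero_flow_imp_coset_eq:
  fixes a :: "nat \<Rightarrow> 'a" and x :: "'k \<Rightarrow> 'a" and k :: "nat \<Rightarrow> 'k" and pos :: "nat \<Rightarrow> bool"
  defines "e \<equiv> \<lambda>p. (k p, H #> a (if pos p then p else Suc p))"
    and "s \<equiv> \<lambda>p. if pos p then 1 else - 1 :: int"
  assumes a: "\<And>p. a p \<in> carrier G" and x: "\<And>y. x y \<in> carrier G"
    and pos: "\<And>p. i \<le> p \<Longrightarrow> p < j \<Longrightarrow> pos p \<Longrightarrow> a (Suc p) = a p \<otimes> x (k p)"
    and neg: "\<And>p. i \<le> p \<Longrightarrow> p < j \<Longrightarrow> \<not> pos p \<Longrightarrow> a p = a (Suc p) \<otimes> x (k p)"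
    and "i \<le> j" and zero: "\<And>y. (\<Sum>p\<in>{i..<j}. if e p = y then s p else 0) = 0"
  shows "derived G H #> a i = derived G H #> a j"
proof -
  let ?D = "derived G H"
  have Dn: "?D \<lhd> G" by (rule derived_is_normal) (rule normal_axioms)
  interpret D: normal ?D G by fact
  have DH: "?D \<subseteq> H" by (rule derived_incl) (auto simp: is_subgroup)
  let ?HG = "G\<lparr>carrier := H\<rparr>"
  let ?A = "?HG Mod ?D"
  interpret A: comm_group ?A by (rule derived_quot_of_subgroup_is_comm_group) (rule is_subgroup)
  \<comment> \<open>a transversal; it need not be a Schreier transversal\<close>
  define t where "t C = (SOME g. g \<in> carrier G \<and> H #> g = C)" for C
  have t: "t (H #> g) \<in> carrier G \<and> H #> t (H #> g) = H #> g" if "g \<in> carrier G" for g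
    unfolding t_def by (rule someI_ex) (use that in blast)
  define b where "b p = a p \<otimes> inv (t (H #> a p))" for p
  have bH: "b p \<in> H" for p
    using t[OF a[of p]] coset_eq_iff[OF a, of "t (H #> a p)" p] by (auto simp: b_def)
  \<comment> \<open>That the ends lie in one coset follows from zero flow as well: the indicator of
    the vertex \<open>H #> a i\<close> changes along an edge by an amount that depends only on the
    edge, so at \<open>j\<close> it still has the value 1.\<close>
  have ends: "H #> a j = H #> a i"
  proof -
    let ?f = "\<lambda>p. of_bool (H #> a p = H #> a i) :: int"
    let ?g = "\<lambda>(l, C). of_bool (H #> (t C \<otimes> x l) = H #> a i) - of_bool (C = H #> a i) :: int"
    have "?f j = ?f i"
    proof (rule telescoping_path_sum[where e = e and s = s and g = ?g])
      fix p assume p: "i \<le> p" "p < j"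
      have *: "H #> (t (H #> a q) \<otimes> x (k p)) = H #> (a q \<otimes> x (k p))" for q
        using t[OF a[of q]] a x by (intro coset_eq_mult_right) auto
      show "?f (Suc p) = ?f p + s p * ?g (e p)"
        using pos[OF p] neg[OF p] by (cases "pos p") (auto simp: e_def s_def *)
    qed fact+
    then show ?thesis by (simp split: if_splits)
  qed
  \<comment> \<open>the factor of the edge \<open>(l, C)\<close>, with a junk value where \<open>t\<close> is unspecified\<close>
  define c where "c = (\<lambda>(l, C). if C \<in> rcosets H then t C \<otimes> x l \<otimes> inv (t (H #> (t C \<otimes> x l))) else \<one>)"
  have tc: "t C \<in> carrier G" if "C \<in> rcosets H" for C
    using that t by (auto simp: RCOSETS_def)
  have cH: "c y \<in> H" for y
  proof (cases y)
    case (Pair l C)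
    show ?thesis
    proof (cases "C \<in> rcosets H")
      case True
      have "t C \<otimes> x l \<in> carrier G" using tc[OF True] x by simp
      then have "t C \<otimes> x l \<otimes> inv (t (H #> (t C \<otimes> x l))) \<in> H"
        using t[of "t C \<otimes> x l"] coset_eq_iff[of "t C \<otimes> x l"] by metis
      then show ?thesis using Pair True by (simp add: c_def)
    qed (simp add: Pair c_def)
  qed
  \<comment> \<open>Insert \<open>inv ?u\<close> times \<open>?u\<close> between \<open>a p\<close>
    and \<open>x l\<close>: the left part is \<open>b p\<close>, the right part is the factor of the
    edge.\<close>
  have link: "b q = b p \<otimes> c (l, H #> a p)" if "a q = a p \<otimes> x l" for p q l
  proof -
    let ?u = "t (H #> a p)"
    have u: "?u \<in> carrier G" "H #> ?u = H #> a p" using t a by auto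
    have "H #> (?u \<otimes> x l) = H #> a q" unfolding that using u a x by (intro coset_eq_mult_right) auto
    moreover have "H #> a p \<in> rcosets H" using a by (auto simp: RCOSETS_def)
    ultimately have "c (l, H #> a p) = ?u \<otimes> x l \<otimes> inv (t (H #> a q))" by (simp add: c_def)
    moreover have "t (H #> a q) \<in> carrier G" using t a by blast
    ultimately show ?thesis
      unfolding b_def that using u a x by (simp add: m_assoc inv_solve_left)
  qed
  define \<phi> where "\<phi> u = ?D #> u" for u
  \<comment> \<open>Cosets of \<open>?D\<close> are the same sets whether formed in \<open>H\<close>
    or in \<open>G\<close>, so equations in the quotient of \<open>H\<close> can be read in
    \<open>G\<close>.\<close>
  have HG: "r_coset ?HG ?D u = ?D #> u" for u by (simp add: r_coset_def)
  have \<phi>c: "\<phi> u \<in> carrier ?A" if "u \<in> H" for u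
    using that by (auto simp: \<phi>_def FactGroup_def RCOSETS_def HG)
  have HC: "u \<in> carrier G" if "u \<in> H" for u using that subset by blast
  have \<phi>m: "\<phi> (u \<otimes> v) = \<phi> u \<otimes>\<^bsub>?A\<^esub> \<phi> v" if "u \<in> H" "v \<in> H" for u v
  proof -
    have "set_mult ?HG P Q = set_mult G P Q" for P Q by (simp add: set_mult_def)
    then show ?thesis using D.rcos_sum HC that by (simp add: \<phi>_def FactGroup_def)
  qed
  have "\<phi> (b j) = \<phi> (b i)"
  proof (rule A.telescoping_path_product[where c = "\<lambda>y. \<phi> (c y)" and e = e and s = s])
    fix p assume p: "i \<le> p" "p < j"
    show "\<phi> (b (Suc p)) = \<phi> (b p) \<otimes>\<^bsub>?A\<^esub> \<phi> (c (e p)) [^]\<^bsub>?A\<^esub> s p"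
    proof (cases "pos p")
      case True
      then show ?thesis
        using link[OF pos[OF p True]] \<phi>m[OF bH cH] \<phi>c[OF cH] by (simp add: e_def s_def)
    next
      case False
      \<comment> \<open>A backward step is a forward step from \<open>Suc p\<close> to
        \<open>p\<close>, which is then solved for the value at \<open>Suc p\<close>.\<close>
      have "\<phi> (b p) = \<phi> (b (Suc p)) \<otimes>\<^bsub>?A\<^esub> \<phi> (c (e p))"
        using link[OF neg[OF p False]] \<phi>m[OF bH cH] False by (simp add: e_def)
      then show ?thesis
        using False \<phi>c[OF cH] \<phi>c[OF bH] by (simp add: s_def A.int_pow_neg A.inv_solve_right del: mult_FactGroup)
    qed
  qed (use \<phi>c bH cH assms in auto)
  then have "?D #> b i = ?D #> b j" by (simp add: \<phi>_def)
  then have "?D #> (b i \<otimes> t (H #> a i)) = ?D #> (b j \<otimes> t (H #> a i))"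
    using bH HC t a by (intro D.coset_eq_mult_right) auto
  moreover have "b p \<otimes> t (H #> a p) = a p" for p
    using t[OF a[of p]] a by (simp add: b_def m_assoc)
  ultimately show ?thesis using ends by metis
qed

section \<open>Flows along a word and Fox derivatives\<close>

definition letter_sign :: "letter \<Rightarrow> int" where
  "letter_sign x = (if snd x then 1 else - 1)"

text \<open>An inverse letter traverses its edge backwards, from the end vertex to the start vertex.\<close>

definition edge_start :: "letter list \<Rightarrow> nat \<Rightarrow> nat" where
  "edge_start w p = (if snd (w ! p) then p else Suc p)"

definition edge :: "nat \<Rightarrow> letter list set \<Rightarrow> letter list \<Rightarrow> nat \<Rightarrow> nat \<times> letter list set" where
  "edge r N w p = (fst (w ! p), N #>\<^bsub>free_group r\<^esub> reduce (take (edge_start w p) w))"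

definition flow ::
  "nat \<Rightarrow> letter list set \<Rightarrow> letter list \<Rightarrow> nat \<Rightarrow> nat \<Rightarrow> nat \<times> letter list set \<Rightarrow> int" where
  "flow r N w i j e = (\<Sum>p\<in>{i..<j}. if edge r N w p = e then letter_sign (w ! p) else 0)"

lemma edge_start_le: "p < length w \<Longrightarrow> edge_start w p \<le> length w"
  by (simp add: edge_start_def)

lemma edge_append_left: "p < length u \<Longrightarrow> edge r N (u @ v) p = edge r N u p"
  by (simp add: edge_def edge_start_def nth_append)

lemma flow_append_left: "j \<le> length u \<Longrightarrow> flow r N (u @ v) i j e = flow r N u i j e"
  unfolding flow_def by (intro sum.cong) (auto simp: edge_append_left nth_append)

lemma flow_split: "i \<le> j \<Longrightarrow> flow r N w 0 j e = flow r N w 0 i e + flow r N w i j e"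
  by (simp add: flow_def sum.atLeastLessThan_concat)

text \<open>Left multiplication by \<open>u\<close> and \<open>act u\<close> are mutually inverse on
  reduced words. The prefixes to which this is applied may be unreduced, a case that
  \<open>act_eq\<close> leaves out.\<close>

lemma reduce_append_eq_iff:
  assumes "reduced g" "reduced y" shows "reduce (u @ y) = g \<longleftrightarrow> y = act u g"
proof -
  have "act u (foldr cancel_cons u y) = y" if "reduced y" for y u
    using that by (induction u arbitrary: y) (auto simp: cancel_cons_inv' reduced_foldr)
  moreover have "foldr cancel_cons u (act u y) = y" if "reduced y" for y u
    using that by (induction u arbitrary: y) (auto simp: cancel_cons_inv reduced_cancel_cons)
  ultimately show ?thesis using assms by (auto simp: reduce_append reduce_reduced)
qed

text \<open>By the product rule each letter contributes its sign times one prefix: the one before it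
  for a generator, whose derivative is 1, and the one including it for an inverse x^-1, whose
  derivative is -x^-1. This is the start vertex of the edge. The induction appends letters at the
  end, so that earlier prefixes stay unchanged.\<close>

lemma word_fox_eq_sum:
  assumes g: "reduced g"
  shows "word_fox k w g = (\<Sum>p<length w.
    if reduce (take (edge_start w p) w) = g then if fst (w ! p) = k then letter_sign (w ! p) else 0 else 0)"
proof (induction w rule: rev_induct)
  case (snoc x u)
  have "word_fox k [x] (act u g) =
      (if reduce (take (edge_start (u @ [x]) (length u)) (u @ [x])) = g
       then if fst x = k then letter_sign x else 0 else 0)"
    using reduce_append_eq_iff[OF g, of "[]" u] reduce_append_eq_iff[OF g, of "[x]" u]
    by (auto simp: gr_basis_def edge_start_def letter_sign_def)
  moreover have "take (edge_start (u @ [x]) p) (u @ [x]) = take (edge_start u p) u" if "p < length u" for p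
    using that edge_start_le[OF that] by (simp add: edge_start_def nth_append)
  ultimately show ?case
    by (simp add: word_fox_append snoc.IH nth_append del: word_fox.simps take_append cong: sum.cong_simp if_cong)
qed simp

text \<open>Several \<open>p\<close> may share the same \<open>h p\<close>, so \<open>a\<close> is a
  sum with like terms not yet collected. Its image can be formed term by term, without knowing which
  terms cancel.\<close>

lemma gr_map_sum:
  assumes "finite P" and a: "\<And>g. a g = (\<Sum>p\<in>P. if h p = g then s p else 0)"
  shows "gr_map \<phi> a y = (\<Sum>p\<in>P. if \<phi> (h p) = y then s p else 0)"
proof -
  have "x \<in> h ` P" if "a x \<noteq> 0" for x
  proof (rule ccontr)
    assume "x \<notin> h ` P"
    then have "(\<Sum>p\<in>P. if h p = x then s p else 0) = 0" by (intro sum.neutral) auto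
    then show False using that a by simp
  qed
  then have "gr_map \<phi> a y = (\<Sum>x\<in>{x \<in> h ` P. \<phi> x = y}. a x)"
    unfolding gr_map_def using assms(1) by (intro sum.mono_neutral_left) auto
  also have "\<dots> = (\<Sum>p\<in>P. \<Sum>x\<in>{x \<in> h ` P. \<phi> x = y}. if h p = x then s p else 0)"
    unfolding a by (rule sum.swap)
  also have "\<dots> = (\<Sum>p\<in>P. if \<phi> (h p) = y then s p else 0)"
    using assms(1) by (intro sum.cong refl) (simp add: sum.delta)
  finally show ?thesis .
qed

lemma gr_map_word_fox:
  "gr_map \<phi> (\<lambda>g. if reduced g then word_fox k w g else 0) c = (\<Sum>p<length w.
    if \<phi> (reduce (take (edge_start w p) w)) = c
    then if fst (w ! p) = k then letter_sign (w ! p) else 0 else 0)"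
  by (rule gr_map_sum) (auto simp: word_fox_eq_sum intro!: sum.neutral)

text \<open>Through the edges labelled \<open>k\<close> the flow of the whole word is the image of
  its Fox derivative in the group ring of F/N. As \<open>word_fox\<close> is invariant under free
  reduction, so is the flow; \<open>flow_reduce\<close> is drawn from this.\<close>

lemma flow_eq_gr_map:
  "flow r N w 0 (length w) (k, c) =
     gr_map (\<lambda>u. N #>\<^bsub>free_group r\<^esub> u) (\<lambda>g. if reduced g then word_fox k w g else 0) c"
  unfolding gr_map_word_fox flow_def
  by (intro sum.cong) (auto simp: edge_def)

lemma flow_reduce:
  "flow r N (reduce w) 0 (length (reduce w)) e = flow r N w 0 (length w) e"
proof (cases e)
  case (Pair k c)
  have "(\<lambda>g. if reduced g then word_fox k (reduce w) g else 0) = (\<lambda>g. if reduced g then word_fox k w g else 0)"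
    by (simp add: word_fox_reduce fun_eq_iff)
  then show ?thesis unfolding Pair flow_eq_gr_map by simp
qed

lemma reduce_append_mult: "reduce (u @ v) = reduce u \<otimes>\<^bsub>free_group r\<^esub> reduce v"
  by (simp add: free_group_def reduce_append_left reduce_append_right)

text \<open>By uniqueness the derivative is \<open>explicit_fox\<close>, whose sum has a single term
  at a basis element.\<close>

lemma fox_derivative_gr_basis:
  assumes "u \<in> carrier (free_group r)"
  shows "fox_derivative r k (gr_basis u) = (\<lambda>g. if reduced g then word_fox k u g else 0)"
proof -
  have "fox_derivative r k = restrict (explicit_fox k) (carrier (group_ring (free_group r)))"
    by (rule fox_unique[OF is_fox_derivative_fox_derivative fox_exists])
  moreover have "{v. gr_basis u v \<noteq> 0} = {u}" by (auto simp: gr_basis_def)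
  ultimately show ?thesis
    using gr_basis_carrier[OF assms] by (simp add: explicit_fox_def fun_eq_iff gr_basis_def)
qed

lemma solvable_fox_derivative_eq_sum:
  assumes "set w \<subseteq> letters r"
  shows "solvable_fox_derivative r d k w c = (\<Sum>p<length w.
    if solv_proj r d (reduce (take (edge_start w p) w)) = c
    then if fst (w ! p) = k then letter_sign (w ! p) else 0 else 0)"
proof -
  have "(\<lambda>g. if reduced g then word_fox k (reduce w) g else 0) = (\<lambda>g. if reduced g then word_fox k w g else 0)"
    by (simp add: word_fox_reduce fun_eq_iff)
  then show ?thesis
    unfolding solvable_fox_derivative_def fox_derivative_gr_basis[OF reduce_in_carrier[OF assms]]
    by (simp add: gr_map_word_fox)
qed

section \<open>Additivity of the flow and classes modulo the derived subgroup\<close>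

context
  fixes r :: nat and N :: "letter list set"
  assumes N: "N \<lhd> free_group r"
begin

interpretation normal N "free_group r" by (fact N)

text \<open>Since N absorbs \<open>u\<close>, the path of \<open>v\<close> started at the end of
  \<open>u\<close> visits the same cosets as the path started at the identity.\<close>

lemma edge_append_right:
  assumes u: "reduce u \<in> N" and v: "set v \<subseteq> letters r" and "p < length v"
  shows "edge r N (u @ v) (length u + p) = edge r N v p"
proof -
  have "N #>\<^bsub>free_group r\<^esub> reduce (u @ take q v) = N #>\<^bsub>free_group r\<^esub> reduce (take q v)" for q
  proof -
    have "reduce (take q v) \<in> carrier (free_group r)"
      using v set_take_subset[of q v] by (intro reduce_in_carrier) auto
    then show ?thesis
      unfolding reduce_append_mult[of u _ r]
      by (metis u coset_mult_assoc coset_join2 is_subgroup mem_carrier subset)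
  qed
  then show ?thesis by (simp add: edge_def edge_start_def nth_append)
qed

lemma flow_append:
  assumes "reduce u \<in> N" "set v \<subseteq> letters r"
  shows "flow r N (u @ v) 0 (length (u @ v)) e =
    flow r N u 0 (length u) e + flow r N v 0 (length v) e"
proof -
  have "flow r N (u @ v) (length u) (length (u @ v)) e = flow r N v 0 (length v) e"
  proof -
    have "(\<Sum>p\<in>{0 + length u..<length v + length u}.
        if edge r N (u @ v) p = e then letter_sign ((u @ v) ! p) else 0) =
      (\<Sum>p\<in>{0..<length v}. if edge r N v p = e then letter_sign (v ! p) else 0)"
      unfolding sum.shift_bounds_nat_ivl
      using edge_append_right[OF assms] by (intro sum.cong) (auto simp: add.commute nth_append)
    then show ?thesis by (simp add: flow_def add.commute)
  qed
  then show ?thesis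
    using flow_split[of "length u" "length (u @ v)" r N "u @ v" e] by (simp add: flow_append_left)
qed

lemma flow_mult:
  assumes "u \<in> N" "v \<in> carrier (free_group r)"
  defines "uv \<equiv> u \<otimes>\<^bsub>free_group r\<^esub> v"
  shows "flow r N uv 0 (length uv) e = flow r N u 0 (length u) e + flow r N v 0 (length v) e"
proof -
  have "reduced u" "set v \<subseteq> letters r"
    using assms subset by (auto simp: free_group_def)
  moreover have "uv = reduce (u @ v)" by (simp add: uv_def free_group_def)
  ultimately show ?thesis using flow_append assms by (simp add: flow_reduce reduce_reduced)
qed

text \<open>By \<open>flow_mult\<close> the flow is a homomorphism from N to the integers. These are
  abelian, so commutators have flow 0, and so has everything they generate.\<close>

lemma flow_derived:
  assumes "u \<in> derived (free_group r) N"
  shows "flow r N u 0 (length u) e = 0"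
proof -
  let ?G = "free_group r"
  let ?F = "\<lambda>u. flow r N u 0 (length u) e"
  have one: "?F \<one>\<^bsub>?G\<^esub> = 0" by (simp add: free_group_def flow_def)
  have mult: "?F (u \<otimes>\<^bsub>?G\<^esub> v) = ?F u + ?F v" if "u \<in> N" "v \<in> N" for u v
    using flow_mult[OF that(1) mem_carrier[OF that(2)]] .
  have inv_flow: "?F (inv\<^bsub>?G\<^esub> u) = - ?F u" if "u \<in> N" for u
    using mult[OF that m_inv_closed[OF that]] one that by simp
  have sub: "derived ?G N \<subseteq> N" by (rule derived_incl) (auto simp: is_subgroup)
  have comm: "?F h = 0 \<and> h \<in> N" if h: "h \<in> derived_set ?G N" for h
  proof -
    obtain u v where "u \<in> N" "v \<in> N" "h = u \<otimes>\<^bsub>?G\<^esub> v \<otimes>\<^bsub>?G\<^esub> inv\<^bsub>?G\<^esub> u \<otimes>\<^bsub>?G\<^esub> inv\<^bsub>?G\<^esub> v"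
      using h by blast
    then show ?thesis using mult inv_flow by simp
  qed
  from assms have "u \<in> generate ?G (derived_set ?G N)" by (simp add: derived_def)
  then show ?thesis
  proof induction
    case (eng h1 h2)
    then have "h1 \<in> N" "h2 \<in> N" using sub by (auto simp: derived_def)
    then show ?case using mult eng by simp
  next
    case (inv h)
    then show ?case using comm[OF inv] inv_flow by simp
  next
    case (incl h)
    then show ?case using comm by blast
  qed (fact one)
qed

text \<open>From left to right, the quotient of the two prefixes lies in the derived subgroup and so
  has zero flow, which is the difference of the flows of the prefixes. The converse is
  \<open>zero_flow_imp_coset_eq\<close> for the path of prefixes.\<close>

lemma derived_coset_eq_iff_flow_eq_0:
  assumes w: "set w \<subseteq> letters r" and ij: "i \<le> j" "j \<le> length w"
  defines "D \<equiv> derived (free_group r) N"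
  shows "D #>\<^bsub>free_group r\<^esub> reduce (take i w) = D #>\<^bsub>free_group r\<^esub> reduce (take j w) \<longleftrightarrow>
    (\<forall>e. flow r N w i j e = 0)"
proof
  let ?G = "free_group r"
  interpret D: normal D ?G unfolding D_def by (rule derived_is_normal) (fact N)
  have prefix: "reduce (take i w) \<in> carrier ?G" for i
    using w set_take_subset[of i w] by (intro reduce_in_carrier) auto
  show "\<forall>e. flow r N w i j e = 0"
    if eq: "D #>\<^bsub>?G\<^esub> reduce (take i w) = D #>\<^bsub>?G\<^esub> reduce (take j w)"
  proof
    fix e
    \<comment> \<open>The quotient stands to the left of the shorter prefix, where
      \<open>flow_mult\<close> expects a factor in \<open>N\<close>.\<close>
    let ?\<delta> = "reduce (take j w) \<otimes>\<^bsub>?G\<^esub> inv\<^bsub>?G\<^esub> reduce (take i w)"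
    have F: "flow r N (reduce (take i w)) 0 (length (reduce (take i w))) e = flow r N w 0 i e"
      if "i \<le> length w" for i
      using that flow_append_left[of i "take i w" r N "drop i w" 0 e] by (simp add: flow_reduce)
    have \<delta>: "?\<delta> \<in> D"
      using D.coset_eq_iff[OF prefix prefix, of j i] eq by simp
    then have "?\<delta> \<in> N" unfolding D_def by (rule derived_incl[OF order_refl is_subgroup, THEN subsetD])
    moreover have "reduce (take j w) = ?\<delta> \<otimes>\<^bsub>?G\<^esub> reduce (take i w)"
      using prefix by (simp add: m_assoc)
    ultimately have "flow r N w 0 j e = flow r N ?\<delta> 0 (length ?\<delta>) e + flow r N w 0 i e"
      using flow_mult[OF _ prefix, of ?\<delta> i e] F ij by simp
    then show "flow r N w i j e = 0"
      using flow_derived \<delta> flow_split[OF ij(1), of r N w e] by (simp add: D_def)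
  qed
  show "D #>\<^bsub>?G\<^esub> reduce (take i w) = D #>\<^bsub>?G\<^esub> reduce (take j w)"
    if zero: "\<forall>e. flow r N w i j e = 0"
    unfolding D_def
  \<comment> \<open>Indices outside \<open>{1..r}\<close> are sent to the identity, because
    \<open>x\<close> has to map every index into the carrier.\<close>
  proof (rule zero_flow_imp_coset_eq[where x = "\<lambda>l. reduce (if l \<in> {1..r} then [(l, True)] else [])"
        and k = "\<lambda>p. fst (w ! p)" and pos = "\<lambda>p. snd (w ! p)"])
    fix p assume p: "i \<le> p" "p < j"
    then have "p < length w" using ij by simp
    then have "w ! p \<in> letters r" using w nth_mem by blast
    then have wp: "take (Suc p) w = take p w @ [w ! p]" "fst (w ! p) \<in> {1..r}"
      using \<open>p < length w\<close> by (simp_all add: take_Suc_conv_app_nth letters_def mem_Times_iff)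
    show "reduce (take (Suc p) w) = reduce (take p w) \<otimes>\<^bsub>?G\<^esub>
        reduce (if fst (w ! p) \<in> {1..r} then [(fst (w ! p), True)] else [])" if sgn: "snd (w ! p)"
    proof -
      obtain l where "w ! p = (l, True)" using sgn by (cases "w ! p") simp
      then show ?thesis using wp by (simp flip: reduce_append_mult)
    qed
    show "reduce (take p w) = reduce (take (Suc p) w) \<otimes>\<^bsub>?G\<^esub>
        reduce (if fst (w ! p) \<in> {1..r} then [(fst (w ! p), True)] else [])" if sgn: "\<not> snd (w ! p)"
    proof -
      obtain l where "w ! p = (l, False)" using sgn by (cases "w ! p") simp
      moreover have "reduce (take p w @ [(l, False), (l, True)]) = reduce (take p w)" for l
        by (simp add: reduce_append) (simp add: reduce_def inv_letter_def)
      ultimately show ?thesis using wp by (simp flip: reduce_append_mult)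
    qed
  next
    fix e
    show "(\<Sum>p\<in>{i..<j}. if (fst (w ! p), N #>\<^bsub>?G\<^esub> reduce (take (if snd (w ! p) then p else Suc p) w)) = e
        then if snd (w ! p) then 1 else - 1 else 0) = (0::int)"
      using zero unfolding flow_def edge_def edge_start_def letter_sign_def by (rule spec)
    show "reduce (if l \<in> {1..r} then [(l, True)] else []) \<in> carrier ?G" for l
      by (cases "l \<in> {1..r}") (auto intro!: reduce_in_carrier simp: letters_def)
  qed (use prefix ij in simp_all)
qed

end

lemma derived_term_Suc: "derived_term r (Suc d) = derived (free_group r) (derived_term r d)"
  by (simp add: derived_term_def)

lemma solv_proj_Suc_eq_iff:
  assumes "set w \<subseteq> letters r" "i \<le> j" "j \<le> length w"
  shows "solv_proj r (Suc d) (reduce (take i w)) = solv_proj r (Suc d) (reduce (take j w)) \<longleftrightarrow>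
    (\<forall>e. flow r (derived_term r d) w i j e = 0)"
  unfolding solv_proj_def derived_term_Suc
  by (rule derived_coset_eq_iff_flow_eq_0[OF normal_derived_term assms])

lemma solv_proj_0_eq:
  assumes "u \<in> carrier (free_group r)"
  shows "solv_proj r 0 u = carrier (free_group r)"
proof -
  interpret group "free_group r" by (rule group_free_group)
  show ?thesis using assms subgroup_self by (simp add: solv_proj_def derived_term_def coset_join2)
qed

section \<open>Reasoning about running time\<close>

definition runs :: "com \<Rightarrow> store \<Rightarrow> nat \<Rightarrow> (store \<Rightarrow> bool) \<Rightarrow> bool" where
  "runs c s T Q \<longleftrightarrow> (\<exists>t s'. exec c s t s' \<and> t \<le> T \<and> Q s')"

lemma runs_weaken: "runs c s T P \<Longrightarrow> (\<And>s'. P s' \<Longrightarrow> Q s') \<Longrightarrow> T \<le> T' \<Longrightarrow> runs c s T' Q"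
  unfolding runs_def by (meson order_trans)

lemma runs_Seq:
  assumes "runs c1 s T1 P" "\<And>s'. P s' \<Longrightarrow> runs c2 s' T2 Q"
  shows "runs (Seq c1 c2) s (T1 + T2) Q"
  using assms unfolding runs_def by (meson exec.Seq add_mono)

lemma runs_CondT: "holds b s \<Longrightarrow> runs c1 s T Q \<Longrightarrow> runs (Cond b c1 c2) s (1 + T) Q"
  unfolding runs_def by (meson exec.CondT add_left_mono)

lemma runs_CondF: "\<not> holds b s \<Longrightarrow> runs c2 s T Q \<Longrightarrow> runs (Cond b c1 c2) s (1 + T) Q"
  unfolding runs_def by (meson exec.CondF add_left_mono)

fun straight_line :: "com \<Rightarrow> bool" where
  "straight_line (Seq c1 c2) \<longleftrightarrow> straight_line c1 \<and> straight_line c2"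
| "straight_line (Cond b c1 c2) \<longleftrightarrow> straight_line c1 \<and> straight_line c2"
| "straight_line (While b c) \<longleftrightarrow> False"
| "straight_line _ \<longleftrightarrow> True"

text \<open>The value at \<open>While\<close> is a dummy; \<open>effect\<close> is tied to
  \<open>exec\<close> for \<open>straight_line\<close> programs only.\<close>

fun effect :: "com \<Rightarrow> store \<Rightarrow> store" where
  "effect Nop s = s"
| "effect (Const x n) s = set_reg x n s"
| "effect (Copy x y) s = set_reg x (reg s y) s"
| "effect (Incr x) s = set_reg x (reg s x + 1) s"
| "effect (Decr x) s = set_reg x (reg s x - 1) s"
| "effect (Load x a i) s = set_reg x (arr s a (reg s i)) s"
| "effect (Store a i x) s = set_arr a (reg s i) (reg s x) s"
| "effect (Seq c1 c2) s = effect c2 (effect c1 s)"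
| "effect (Cond b c1 c2) s = (if holds b s then effect c1 s else effect c2 s)"
| "effect (While b c) s = s"

fun cost :: "com \<Rightarrow> nat" where
  "cost (Seq c1 c2) = cost c1 + cost c2"
| "cost (Cond b c1 c2) = 1 + max (cost c1) (cost c2)"
| "cost _ = 1"

text \<open>Loop-free code can thus be verified by rewriting: \<open>effect\<close> computes the
  final store, and \<open>cost\<close> charges the dearer branch of each conditional.\<close>

lemma straight_line_runs:
  assumes "straight_line c" "cost c \<le> T" "Q (effect c s)"
  shows "runs c s T Q"
proof -
  have "\<exists>t\<le>cost c. exec c s t (effect c s)"
    using assms(1)
  proof (induction c arbitrary: s)
    case (Seq c1 c2)
    then obtain t1 t2 where "t1 \<le> cost c1" "exec c1 s t1 (effect c1 s)"
      "t2 \<le> cost c2" "exec c2 (effect c1 s) t2 (effect c2 (effect c1 s))"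
      by (metis straight_line.simps(1))
    then show ?case by (intro exI[of _ "t1 + t2"]) (auto intro: exec.Seq)
  next
    case (Cond b c1 c2)
    show ?case
    proof (cases "holds b s")
      case True
      then obtain t where "t \<le> cost c1" "exec c1 s t (effect c1 s)"
        using Cond by auto
      then show ?thesis using True by (intro exI[of _ "1 + t"]) (auto intro: exec.CondT[simplified])
    next
      case False
      then obtain t where "t \<le> cost c2" "exec c2 s t (effect c2 s)"
        using Cond by auto
      then show ?thesis using False by (intro exI[of _ "1 + t"]) (auto intro: exec.CondF[simplified])
    qed
  qed (auto intro!: exI[of _ 1] exec.Nop exec.Const exec.Copy exec.Incr exec.Decr exec.Load exec.Store
      simp del: One_nat_def)
  then show ?thesis using assms(2,3) unfolding runs_def by (meson order_trans)
qed

definition For :: "nat \<Rightarrow> nat \<Rightarrow> com \<Rightarrow> com" where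
  "For x y c = While (Less x y) (Seq c (Incr x))"

text \<open>Each round pays for the body and two more steps, the test and the increment; the final 1
  is the failing test. The increment is part of the postcondition of the body, so that the invariant
  always refers to the loop head.\<close>

lemma runs_For:
  assumes "I a s" "a \<le> b"
    and bounds: "\<And>i s. I i s \<Longrightarrow> reg s x = int i \<and> reg s y = int b"
    and body: "\<And>i s. a \<le> i \<Longrightarrow> i < b \<Longrightarrow> I i s \<Longrightarrow> runs c s T (\<lambda>s'. I (Suc i) (set_reg x (reg s' x + 1) s'))"
  shows "runs (For x y c) s ((b - a) * (T + 2) + 1) (I b)"
proof -
  have "runs (For x y c) s ((b - i) * (T + 2) + 1) (I b)" if "i \<le> b" "a \<le> i" "I i s" for i s
    using that
  proof (induction i arbitrary: s rule: inc_induct)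
    case base
    then have "\<not> holds (Less x y) s" using bounds by simp
    then have "exec (For x y c) s 1 s" unfolding For_def by (rule exec.WhileF)
    then show ?case using base unfolding runs_def by (metis le_add2)
  next
    case (step i)
    then have "holds (Less x y) s" using bounds by simp
    moreover obtain t1 s1 where 1: "exec c s t1 s1" "t1 \<le> T" "I (Suc i) (set_reg x (reg s1 x + 1) s1)"
      using body[of i s] step unfolding runs_def by auto
    moreover obtain t2 s2 where 2: "exec (For x y c) (set_reg x (reg s1 x + 1) s1) t2 s2"
        "t2 \<le> (b - Suc i) * (T + 2) + 1" "I b s2"
      using step.IH[OF _ 1(3)] step.prems unfolding runs_def by auto
    ultimately have "exec (For x y c) s (1 + (t1 + 1) + t2) s2"
      unfolding For_def by (intro exec.WhileT[OF _ exec.Seq[OF _ exec.Incr]])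
    moreover have "1 + (t1 + 1) + t2 \<le> (b - i) * (T + 2) + 1"
    proof -
      have "b - i = Suc (b - Suc i)" using step.hyps by simp
      then show ?thesis using 1(2) 2(2) by simp
    qed
    ultimately show ?case using 2(3) unfolding runs_def by blast
  qed
  then show ?thesis using assms by blast
qed

lemma set_reg_simps [simp]:
  "reg (set_reg x v s) = (reg s)(x := v)" "arr (set_reg x v s) = arr s"
  "set_reg x u (set_reg x v s) = set_reg x u s"
  by (simp_all add: set_reg_def)

lemma set_arr_simps [simp]:
  "arr (set_arr a i v s) = (arr s)(a := (arr s a)(i := v))" "reg (set_arr a i v s) = reg s"
  by (simp_all add: set_arr_def)

text \<open>The recursion mirrors an upward scan that overwrites its result at every hit, so one
  round of such a loop unfolds it once. Without a hit the value is 0.\<close>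

fun last_below :: "(nat \<Rightarrow> bool) \<Rightarrow> nat \<Rightarrow> nat" where
  "last_below P 0 = 0"
| "last_below P (Suc n) = (if P n then n else last_below P n)"

lemma last_below:
  "P i \<Longrightarrow> i < n \<Longrightarrow> P (last_below P n) \<and> i \<le> last_below P n \<and> last_below P n < n"
  by (induction n) (auto simp: less_Suc_eq)

lemma last_below_cong: "(\<And>i. i < n \<Longrightarrow> P i = Q i) \<Longrightarrow> last_below P n = last_below Q n"
  by (induction n) auto

text \<open>Both searches have a hit at \<open>i\<close>, so both end at or above \<open>i\<close>,
  where the predicates agree.\<close>

lemma last_below_le_imp_eq:
  assumes "i < n" "Q i" "\<And>j. j < n \<Longrightarrow> i \<le> j \<Longrightarrow> P j = Q j"
  shows "last_below P n = last_below Q n"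
  using assms by (induction n) (auto simp: less_Suc_eq)

section \<open>Labelling the prefixes\<close>

text \<open>Register usage: 3 holds \<open>|w|\<close>, 4 the constant 0, 5 \<open>|w| + 1\<close>, 6 the level, 9 the number of
  edges with nonzero flow. Array usage: 4 holds the labels of the prefixes, 5 the labels of the
  edges, 6 the flow, 7 the collected coefficients.\<close>

definition edge_label :: "letter list \<Rightarrow> (nat \<Rightarrow> nat) \<Rightarrow> nat \<Rightarrow> nat" where
  "edge_label w R p = last_below
     (\<lambda>q. R (edge_start w p) = R (edge_start w q) \<and> fst (w ! p) = fst (w ! q)) (length w)"

definition label_flow :: "letter list \<Rightarrow> (nat \<Rightarrow> nat) \<Rightarrow> nat \<Rightarrow> nat \<Rightarrow> nat \<Rightarrow> int" where
  "label_flow w E i j e = (\<Sum>p\<in>{i..<j}. if E p = e then letter_sign (w ! p) else 0)"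

text \<open>Searching from \<open>i\<close> onwards is enough, since the last member of a class is
  found from each of its members. The bound \<open>Suc (length w)\<close> admits the full word as a
  prefix.\<close>

definition next_label :: "letter list \<Rightarrow> (nat \<Rightarrow> nat) \<Rightarrow> nat \<Rightarrow> nat" where
  "next_label w E i = last_below (\<lambda>j. i \<le> j \<and> (\<forall>e<length w. label_flow w E i j e = 0)) (Suc (length w))"

definition ready :: "nat \<Rightarrow> nat \<Rightarrow> letter list \<Rightarrow> nat \<Rightarrow> store \<Rightarrow> bool" where
  "ready d k w m s \<longleftrightarrow>
     reg s 1 = int d \<and> reg s 2 = int k \<and> reg s 3 = int (length w) \<and> reg s 4 = 0 \<and>
     reg s 5 = int (Suc (length w)) \<and> reg s 6 = int m \<and>
     (\<forall>p<length w. arr s 0 (int p) = int (fst (w ! p)) \<and> arr s 1 (int p) = letter_sign (w ! p))"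

definition holds_labels :: "nat \<Rightarrow> nat \<Rightarrow> (nat \<Rightarrow> nat) \<Rightarrow> store \<Rightarrow> bool" where
  "holds_labels a n R s \<longleftrightarrow> (\<forall>i<n. arr s a (int i) = int (R i))"

lemma ready_frame [simp]:
  "x = 0 \<or> 6 < x \<Longrightarrow> ready d k w m (set_reg x v s) = ready d k w m s"
  "1 < a \<Longrightarrow> ready d k w m (set_arr a i v s) = ready d k w m s"
  by (auto simp: ready_def)

lemma holds_labels_frame [simp]:
  "holds_labels a n R (set_reg x v s) = holds_labels a n R s"
  "a \<noteq> b \<Longrightarrow> holds_labels a n R (set_arr b i v s) = holds_labels a n R s"
  by (auto simp: holds_labels_def)

lemma holds_labels_0 [simp]: "holds_labels a 0 R s"
  by (simp add: holds_labels_def)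

lemma holds_labels_Suc:
  "holds_labels a (Suc n) R s \<longleftrightarrow> holds_labels a n R s \<and> arr s a (int n) = int (R n)"
  by (auto simp: holds_labels_def less_Suc_eq)

lemma holds_labels_set_arr [simp]:
  "int n \<le> i \<Longrightarrow> holds_labels a n R (set_arr a i v s) = holds_labels a n R s"
  by (auto simp: holds_labels_def)

lemma readyD:
  assumes "ready d k w m s"
  shows "reg s 1 = int d" "reg s (Suc 0) = int d" "reg s 2 = int k" "reg s 3 = int (length w)" "reg s 4 = 0"
    "reg s 5 = int (Suc (length w))" "reg s 6 = int m"
    "p < length w \<Longrightarrow> arr s 0 (int p) = int (fst (w ! p))"
    "p < length w \<Longrightarrow> arr s 1 (int p) = letter_sign (w ! p)"
    "p < length w \<Longrightarrow> arr s (Suc 0) (int p) = letter_sign (w ! p)"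
  using assms by (auto simp: ready_def)

section \<open>Computing the edge labels\<close>

definition start_label_prog :: "nat \<Rightarrow> nat \<Rightarrow> com" where
  "start_label_prog x y =
     Seq (Load 10 1 y) (Seq (Copy x y) (Seq (Cond (Less 10 4) (Incr x) Nop) (Load x 4 x)))"

lemma start_label_prog [simp]:
  assumes "ready d k w m s" "holds_labels 4 (Suc (length w)) R s" "reg s y = int p" "p < length w"
    "x \<noteq> 4" "x \<noteq> 10" "y \<noteq> 10"
  shows "effect (start_label_prog x y) s =
    set_reg x (int (R (edge_start w p))) (set_reg 10 (letter_sign (w ! p)) s)"
proof -
  have "arr s 4 (int (edge_start w p)) = int (R (edge_start w p))"
    using assms(2) edge_start_le[OF assms(4)] by (simp add: holds_labels_def)
  then show ?thesis
    using assms readyD[OF assms(1)]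
    by (auto simp: start_label_prog_def edge_start_def letter_sign_def add.commute)
qed

lemma start_label_prog_props [simp]:
  "straight_line (start_label_prog x y)" "cost (start_label_prog x y) = 5"
  by (simp_all add: start_label_prog_def)

definition edge_label_body :: com where
  "edge_label_body =
     Seq (start_label_prog 13 8) (Seq (Load 14 0 8)
       (Cond (Equal 11 13) (Cond (Equal 12 14) (Store 5 7 8) Nop) Nop))"

definition edge_label_prog :: com where
  "edge_label_prog =
     Seq (Const 7 0) (For 7 3
       (Seq (Seq (start_label_prog 11 7) (Seq (Load 12 0 7) (Seq (Store 5 7 4) (Const 8 0))))
         (For 8 3 edge_label_body)))"

lemma runs_edge_label_prog:
  assumes "ready d k w m s" "holds_labels 4 (Suc (length w)) R s"
  shows "runs edge_label_prog s (20 * Suc (length w) ^ 2)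
    (\<lambda>s'. ready d k w m s' \<and> holds_labels 5 (length w) (edge_label w R) s')"
proof -
  let ?n = "length w"
  let ?init = "Seq (start_label_prog 11 7) (Seq (Load 12 0 7) (Seq (Store 5 7 4) (Const 8 0)))"
  let ?J = "\<lambda>p s. ready d k w m s \<and> holds_labels 4 (Suc ?n) R s \<and> reg s 7 = int p \<and>
    holds_labels 5 p (edge_label w R) s"
  let ?same = "\<lambda>p q. R (edge_start w p) = R (edge_start w q) \<and> fst (w ! p) = fst (w ! q)"
  \<comment> \<open>After \<open>q\<close> rounds the entry for \<open>p\<close> is the last match
    below \<open>q\<close>; the 0 stored by \<open>?init\<close> is the value of
    \<open>last_below\<close> at 0.\<close>
  let ?I = "\<lambda>p q s. ?J p s \<and> reg s 8 = int q \<and> reg s 11 = int (R (edge_start w p)) \<and>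
    reg s 12 = int (fst (w ! p)) \<and> arr s 5 (int p) = int (last_below (?same p) q)"
  have body: "runs edge_label_body s 9 (\<lambda>s'. ?I p (Suc q) (set_reg 8 (reg s' 8 + 1) s'))"
    if I: "?I p q s" and p: "p < ?n" and q: "q < ?n" for p q s
  proof -
    have r: "ready d k w m s" using I by simp
    have "effect (start_label_prog 13 8) s =
        set_reg 13 (int (R (edge_start w q))) (set_reg 10 (letter_sign (w ! q)) s)"
      using I q by (intro start_label_prog[OF r]) auto
    note effect = this readyD[OF r]
    show ?thesis
      by (rule straight_line_runs)
        (use I p q in \<open>auto simp: edge_label_body_def effect\<close>)
  qed
  have init: "runs ?init s 9 (?I p 0)"
    if J: "?J p s" and p: "p < ?n" for p s
  proof -
    have r: "ready d k w m s" using J by simp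
    have "effect (start_label_prog 11 7) s =
        set_reg 11 (int (R (edge_start w p))) (set_reg 10 (letter_sign (w ! p)) s)"
      using J p by (intro start_label_prog[OF r]) auto
    note effect = this readyD[OF r]
    show ?thesis
      by (rule straight_line_runs) (use J p in \<open>auto simp: effect\<close>)
  qed
  have loop: "runs (For 8 3 edge_label_body) s ((?n - 0) * (9 + 2) + 1) (?I p ?n)"
    if "?I p 0 s" "p < ?n" for p s
    by (rule runs_For[where I = "?I p"]) (use that body readyD(4) in auto)
  have inner: "runs (Seq ?init (For 8 3 edge_label_body)) s (9 + ((?n - 0) * (9 + 2) + 1))
       (\<lambda>s'. ?J (Suc p) (set_reg 7 (reg s' 7 + 1) s'))"
    if "?J p s" "p < ?n" for p s
    using that by (intro runs_weaken[OF runs_Seq[OF init loop]])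
      (auto simp: holds_labels_Suc edge_label_def)
  have outer: "runs (For 7 3 (Seq ?init (For 8 3 edge_label_body))) s ((?n - 0) * (9 + ((?n - 0) * (9 + 2) + 1) + 2) + 1) (?J ?n)"
    if "?J 0 s" for s
    by (rule runs_For[where I = ?J, OF that]) (use inner readyD(4) in auto)
  have "runs edge_label_prog s (1 + ((?n - 0) * (9 + ((?n - 0) * (9 + 2) + 1) + 2) + 1)) (?J ?n)"
    unfolding edge_label_prog_def
  proof (rule runs_Seq)
    show "runs (Const 7 0) s 1 (?J 0)"
      by (rule straight_line_runs) (use assms in auto)
  qed (rule outer)
  \<comment> \<open>With n = \<open>length w\<close> the bound obtained is 11 n^2 + 12 n +
    2.\<close>
  then show ?thesis
    by (rule runs_weaken) (auto simp: power2_eq_square algebra_simps)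
qed

section \<open>Updating the flow and computing the next labels\<close>

definition nonzero_count :: "nat \<Rightarrow> (nat \<Rightarrow> int) \<Rightarrow> int" where
  "nonzero_count n f = (\<Sum>e<n. of_bool (f e \<noteq> 0))"

lemma nonzero_count_eq_0_iff: "nonzero_count n f = 0 \<longleftrightarrow> (\<forall>e<n. f e = 0)"
  unfolding nonzero_count_def by (subst sum_nonneg_eq_0_iff) auto

lemma nonzero_count_upd:
  assumes "e < n"
  shows "nonzero_count n (f(e := v)) = nonzero_count n f - of_bool (f e \<noteq> 0) + of_bool (v \<noteq> 0)"
proof -
  have "nonzero_count n g = of_bool (g e \<noteq> 0) + (\<Sum>e'\<in>{..<n} - {e}. of_bool (g e' \<noteq> 0))" for g
    unfolding nonzero_count_def using assms by (intro sum.remove) auto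
  from this[of f] this[of "f(e := v)"] show ?thesis by simp
qed

lemma label_flow_Suc:
  "i \<le> j \<Longrightarrow> label_flow w E i (Suc j) =
    (label_flow w E i j)(E j := label_flow w E i j (E j) + letter_sign (w ! j))"
  by (auto simp: label_flow_def)

text \<open>Register 9 goes up if the old flow is 0 and down if the new flow is 0, which is exactly
  the change in the number of nonzero flows. When it reaches 0, the prefix just completed becomes
  the label of the prefix in register 7.\<close>

definition label_flow_body :: com where
  "label_flow_body =
     Seq (Load 11 5 8) (Seq (Load 12 6 11) (Seq (Cond (Equal 12 4) (Incr 9) Nop)
       (Seq (Load 10 1 8) (Seq (Cond (Less 10 4) (Decr 12) (Incr 12))
       (Seq (Cond (Equal 12 4) (Decr 9) Nop) (Seq (Store 6 11 12)
       (Seq (Copy 13 8) (Seq (Incr 13) (Cond (Equal 9 4) (Store 4 7 13) Nop)))))))))"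

text \<open>The new labels may overwrite the old ones in array 4, because this phase reads the edges
  from array 5.\<close>

definition next_label_prog :: com where
  "next_label_prog =
     Seq (Const 7 0) (For 7 5
       (Seq (Seq (Const 8 0) (For 8 3 (Store 6 8 4)))
         (Seq (Seq (Const 9 0) (Seq (Copy 8 7) (Store 4 7 7)))
           (For 8 3 label_flow_body))))"

lemma effect_label_flow_body:
  fixes s :: store
  defines "j \<equiv> reg s 8" defines "e \<equiv> arr s 5 j" defines "v \<equiv> arr s 6 e + arr s 1 j"
    and "c \<equiv> reg s 9 - of_bool (arr s 6 e \<noteq> 0) + of_bool (arr s 6 e + arr s 1 j \<noteq> 0)"
  assumes "reg s 4 = 0" "arr s 1 j = 1 \<or> arr s 1 j = - 1"
  shows "x < 9 \<Longrightarrow> reg (effect label_flow_body s) x = reg s x"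
    and "reg (effect label_flow_body s) 9 = c"
    and "arr (effect label_flow_body s) = (\<lambda>a i.
      if a = 6 \<and> i = e then v else if a = 4 \<and> i = reg s 7 \<and> c = 0 then j + 1 else arr s a i)"
proof -
  have "(x < 9 \<longrightarrow> reg (effect label_flow_body s) x = reg s x) \<and>
    reg (effect label_flow_body s) 9 = c \<and>
    arr (effect label_flow_body s) = (\<lambda>a i.
      if a = 6 \<and> i = e then v else if a = 4 \<and> i = reg s 7 \<and> c = 0 then j + 1 else arr s a i)"
  proof (cases "arr s 1 j = 1")
    case True
    note 1 = True
    show ?thesis
    proof (cases "arr s 6 e = 0")
      case True
      then show ?thesis
        using 1 assms(5) unfolding j_def e_def v_def c_def
        by (simp add: label_flow_body_def fun_eq_iff)
    next
      \<comment> \<open>A positive letter makes a nonzero flow vanish exactly if it was -1, hence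
        the further case distinction.\<close>
      case False
      then show ?thesis
        using 1 assms(5) unfolding j_def e_def v_def c_def
        by (cases "arr s 6 (arr s 5 (reg s 8)) = -1") (simp_all add: label_flow_body_def fun_eq_iff)
    qed
  next
    case False
    then have 1: "arr s 1 j = - 1" using assms by blast
    show ?thesis
    proof (cases "arr s 6 e = 0")
      case True
      then show ?thesis
        using 1 assms(5) unfolding j_def e_def v_def c_def
        by (simp add: label_flow_body_def fun_eq_iff)
    next
      case False
      then show ?thesis
        using 1 assms(5) unfolding j_def e_def v_def c_def
        by (cases "arr s 6 (arr s 5 (reg s 8)) = 1") (simp_all add: label_flow_body_def fun_eq_iff)
    qed
  qed
  then show "x < 9 \<Longrightarrow> reg (effect label_flow_body s) x = reg s x"
    and "reg (effect label_flow_body s) 9 = c"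
    and "arr (effect label_flow_body s) = (\<lambda>a i.
      if a = 6 \<and> i = e then v else if a = 4 \<and> i = reg s 7 \<and> c = 0 then j + 1 else arr s a i)"
    by blast+
qed

lemma runs_next_label_prog:
  assumes "ready d k w m s" "holds_labels 5 (length w) E s"
    and E: "\<And>p. p < length w \<Longrightarrow> E p < length w"
  shows "runs next_label_prog s (30 * Suc (length w) ^ 2)
    (\<lambda>s'. ready d k w m s' \<and> holds_labels 4 (Suc (length w)) (next_label w E) s')"
proof -
  let ?n = "length w"
  let ?clear = "Seq (Const 8 0) (For 8 3 (Store 6 8 4))" and ?start = "Seq (Const 9 0) (Seq (Copy 8 7) (Store 4 7 7))"
  let ?J = "\<lambda>i s. ready d k w m s \<and> holds_labels 5 ?n E s \<and> reg s 7 = int i \<and>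
    holds_labels 4 i (next_label w E) s"
  let ?C = "\<lambda>i l s. ?J i s \<and> reg s 8 = int l \<and> (\<forall>e<l. arr s 6 (int e) = 0)"
  let ?closed = "\<lambda>i j. i \<le> j \<and> (\<forall>e<?n. label_flow w E i j e = 0)"
  \<comment> \<open>At the loop head the prefixes up to and including length \<open>j\<close> have
    been examined, hence \<open>Suc j\<close>.\<close>
  let ?I = "\<lambda>i j s. ?J i s \<and> reg s 8 = int j \<and> (\<forall>e<?n. arr s 6 (int e) = label_flow w E i j e) \<and>
    reg s 9 = nonzero_count ?n (label_flow w E i j) \<and>
    arr s 4 (int i) = int (last_below (?closed i) (Suc j))"
  have clear_body: "runs (Store 6 8 4) s 1 (\<lambda>s'. ?C i (Suc l) (set_reg 8 (reg s' 8 + 1) s'))"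
    if I: "?C i l s" for i l s
  proof -
    have r: "ready d k w m s" using I by simp
    show ?thesis
      by (rule straight_line_runs)
        (use I in \<open>auto simp: readyD[OF r] less_Suc_eq\<close>)
  qed
  have clear: "runs ?clear s (1 + ((?n - 0) * (1 + 2) + 1)) (?C i ?n)"
    if J: "?J i s" for i s
  proof (rule runs_Seq)
    show "runs (Const 8 0) s 1 (?C i 0)"
      by (rule straight_line_runs) (use J in auto)
    fix s' assume "?C i 0 s'"
    then show "runs (For 8 3 (Store 6 8 4)) s' ((?n - 0) * (1 + 2) + 1) (?C i ?n)"
      by (rule runs_For[where I = "?C i"]) (use clear_body readyD(4) in auto)
  qed
  have body: "runs label_flow_body s 14 (\<lambda>s'. ?I i (Suc j) (set_reg 8 (reg s' 8 + 1) s'))"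
    if I: "?I i j s" and i: "i \<le> j" and j: "j < ?n" for i j s
  proof -
    have r: "ready d k w m s" using I by simp
    have e: "arr s 5 (int j) = int (E j)" "arr s 6 (int (E j)) = label_flow w E i j (E j)"
      using I j E by (auto simp: holds_labels_def)
    have 8: "reg s 8 = int j" and 7: "reg s 7 = int i" using I by auto
    have letter: "arr s 1 (int j) = letter_sign (w ! j)" using readyD(9)[OF r j] .
    define s' where "s' = effect label_flow_body s"
    let ?f = "label_flow w E i (Suc j)"
    have sign: "arr s 1 (reg s 8) = 1 \<or> arr s 1 (reg s 8) = - 1"
      using letter 8 by (simp add: letter_sign_def)
    have count: "nonzero_count ?n ?f = nonzero_count ?n (label_flow w E i j)
        - of_bool (label_flow w E i j (E j) \<noteq> 0) + of_bool (label_flow w E i j (E j) + letter_sign (w ! j) \<noteq> 0)"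
      using i E[OF j] by (simp add: label_flow_Suc nonzero_count_upd)
    have regs: "x < 9 \<Longrightarrow> reg s' x = reg s x" for x
      unfolding s'_def using effect_label_flow_body(1)[OF readyD(5)[OF r] sign] .
    have 9: "reg s' 9 = nonzero_count ?n ?f"
      unfolding s'_def effect_label_flow_body(2)[OF readyD(5)[OF r] sign] count
      using I letter e by (simp add: 8)
    have arrs: "arr s' = (\<lambda>a x. if a = 6 \<and> x = int (E j) then ?f (E j)
        else if a = 4 \<and> x = int i \<and> ?closed i (Suc j) then int (Suc j) else arr s a x)"
    proof -
      have "nonzero_count ?n (label_flow w E i j) - of_bool (label_flow w E i j (E j) \<noteq> 0)
          + of_bool (label_flow w E i j (E j) + letter_sign (w ! j) \<noteq> 0) = 0 \<longleftrightarrow> ?closed i (Suc j)"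
        unfolding count[symmetric] using i by (simp add: nonzero_count_eq_0_iff)
      moreover have "?f (E j) = label_flow w E i j (E j) + letter_sign (w ! j)"
        using i by (simp add: label_flow_Suc)
      moreover have "reg s 9 = nonzero_count ?n (label_flow w E i j)" using I by simp
      ultimately show ?thesis
        unfolding s'_def effect_label_flow_body(3)[OF readyD(5)[OF r] sign]
        by (simp only: 7 8 e letter of_nat_Suc add.commute)
    qed
    have "ready d k w m s'" using r regs by (simp add: ready_def arrs)
    moreover have "holds_labels 5 ?n E s'" "holds_labels 4 i (next_label w E) s'"
      using I by (simp_all add: holds_labels_def arrs)
    moreover have "arr s' 6 (int l) = ?f l" if "l < ?n" for l
      using I that i by (simp add: arrs label_flow_Suc)
    moreover have "arr s' 4 (int i) = int (last_below (?closed i) (Suc (Suc j)))"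
      using I by (auto simp: arrs)
    ultimately have Q: "?I i (Suc j) (set_reg 8 (reg s' 8 + 1) s')"
      using regs[of 7] regs[of 8] 7 8 9 by (simp del: last_below.simps)
    show ?thesis
    proof (rule straight_line_runs)
      show "straight_line label_flow_body" "cost label_flow_body \<le> 14"
        by (simp_all add: label_flow_body_def)
    qed (use Q in \<open>unfold s'_def\<close>)
  qed
  \<comment> \<open>The empty piece from \<open>i\<close> to \<open>i\<close> has zero flow, so the
    scan begins with label \<open>i\<close> and counter 0.\<close>
  have start: "runs ?start s 3 (?I i i)"
    if C: "?C i ?n s" for i s
  proof -
    have "label_flow w E i i = (\<lambda>e. 0)" by (simp add: label_flow_def fun_eq_iff)
    then show ?thesis by (intro straight_line_runs) (use C in \<open>simp_all add: nonzero_count_def\<close>)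
  qed
  have loop: "runs (For 8 3 label_flow_body) s ((?n - i) * (14 + 2) + 1) (?I i ?n)"
    if "?I i i s" "i \<le> ?n" for i s
    by (rule runs_For[where I = "?I i"]) (use that body readyD(4) in auto)
  \<comment> \<open>Clearing costs 3 n + 2, the start 3, and the scan from \<open>i\<close> at most
    16 n + 1, where n = \<open>length w\<close>.\<close>
  have inner: "runs (Seq ?clear (Seq ?start (For 8 3 label_flow_body))) s (6 + ?n * 19) (\<lambda>s'. ?J (Suc i) (set_reg 7 (reg s' 7 + 1) s'))"
    if "?J i s" "i < Suc ?n" for i s
    using that by (intro runs_weaken[OF runs_Seq[OF clear runs_Seq[OF start loop]]])
      (auto simp: holds_labels_Suc next_label_def diff_mult_distrib)
  have outer: "runs (For 7 5 (Seq ?clear (Seq ?start (For 8 3 label_flow_body)))) s ((Suc ?n - 0) * (6 + ?n * 19 + 2) + 1) (?J (Suc ?n))"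
    if "?J 0 s" for s
    by (rule runs_For[where I = ?J, OF that]) (use inner readyD(6) in auto)
  have "runs next_label_prog s (1 + ((Suc ?n - 0) * (6 + ?n * 19 + 2) + 1)) (?J (Suc ?n))"
    unfolding next_label_prog_def
  proof (rule runs_Seq)
    show "runs (Const 7 0) s 1 (?J 0)"
      by (rule straight_line_runs) (use assms in auto)
  qed (rule outer)
  then show ?thesis
    by (rule runs_weaken) (auto simp: power2_eq_square algebra_simps)
qed

section \<open>Correctness of the labels\<close>

definition prefix_class :: "nat \<Rightarrow> nat \<Rightarrow> letter list \<Rightarrow> nat \<Rightarrow> letter list set" where
  "prefix_class r m w i = solv_proj r m (reduce (take i w))"

text \<open>The first clause lets a label serve as the length of a prefix representing the class, as
  the output requires. Together the clauses make labels agree exactly when the classes do.\<close>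

definition valid_labels :: "nat \<Rightarrow> nat \<Rightarrow> letter list \<Rightarrow> (nat \<Rightarrow> nat) \<Rightarrow> bool" where
  "valid_labels r m w R \<longleftrightarrow>
     (\<forall>i\<le>length w. R i \<le> length w \<and> prefix_class r m w (R i) = prefix_class r m w i) \<and>
     (\<forall>i\<le>length w. \<forall>j\<le>length w. prefix_class r m w i = prefix_class r m w j \<longrightarrow> R i = R j)"

lemma valid_labels_eq_iff:
  "valid_labels r m w R \<Longrightarrow> i \<le> length w \<Longrightarrow> j \<le> length w \<Longrightarrow>
    R i = R j \<longleftrightarrow> prefix_class r m w i = prefix_class r m w j"
  unfolding valid_labels_def by metis

lemma reduce_take_in_carrier:
  "set w \<subseteq> letters r \<Longrightarrow> reduce (take i w) \<in> carrier (free_group r)"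
  by (meson reduce_in_carrier order_trans set_take_subset)

text \<open>At level 0 one factors out the whole free group, so all prefixes share one class,
  represented by the empty prefix. An array filled with zeros is therefore a correct
  labelling.\<close>

lemma valid_labels_0: "set w \<subseteq> letters r \<Longrightarrow> valid_labels r 0 w (\<lambda>_. 0)"
  unfolding valid_labels_def prefix_class_def by (simp only: solv_proj_0_eq[OF reduce_take_in_carrier]) simp

lemma edge_label_less: "p < length w \<Longrightarrow> edge_label w R p < length w"
  unfolding edge_label_def
  using last_below[of "\<lambda>q. R (edge_start w p) = R (edge_start w q) \<and> fst (w ! p) = fst (w ! q)" p "length w"]
  by simp

text \<open>\<open>?same\<close> is an equivalence relation, so two positions have the same last
  partner just when they are equivalent; \<open>R\<close> then identifies the start
  vertices.\<close>

lemma edge_label_eq_iff: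
  assumes R: "valid_labels r m w R" and p: "p < length w" and q: "q < length w"
  shows "edge_label w R p = edge_label w R q \<longleftrightarrow>
    edge r (derived_term r m) w p = edge r (derived_term r m) w q"
proof -
  let ?same = "\<lambda>p q. R (edge_start w p) = R (edge_start w q) \<and> fst (w ! p) = fst (w ! q)"
  have "edge_label w R p = edge_label w R q \<longleftrightarrow> ?same p q"
  proof
    assume eq: "edge_label w R p = edge_label w R q"
    have "?same p (edge_label w R p)" "?same q (edge_label w R q)"
      unfolding edge_label_def
      using last_below[of "?same p" p "length w"] last_below[of "?same q" q "length w"] p q by auto
    then show "?same p q" using eq by simp
  next
    assume "?same p q"
    then have "?same p = ?same q" by auto
    then show "edge_label w R p = edge_label w R q" by (simp only: edge_label_def)
  qed
  also have "\<dots> \<longleftrightarrow> edge r (derived_term r m) w p = edge r (derived_term r m) w q"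
    using valid_labels_eq_iff[OF R edge_start_le[OF p] edge_start_le[OF q]]
    by (auto simp: edge_def prefix_class_def solv_proj_def)
  finally show ?thesis .
qed

text \<open>Along the piece, edges and their labels correspond one to one, so the flows agree.
  Labels and edges not met between \<open>i\<close> and \<open>j\<close> carry no flow on either
  side.\<close>

lemma label_flow_eq_0_iff:
  assumes R: "valid_labels r m w R" and w: "set w \<subseteq> letters r" and ij: "i \<le> j" "j \<le> length w"
  shows "(\<forall>e<length w. label_flow w (edge_label w R) i j e = 0) \<longleftrightarrow>
    prefix_class r (Suc m) w i = prefix_class r (Suc m) w j"
proof -
  let ?E = "edge_label w R" and ?N = "derived_term r m"
  have eq: "label_flow w ?E i j (?E p) = flow r ?N w i j (edge r ?N w p)" if "p \<in> {i..<j}" for p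
    unfolding label_flow_def flow_def
    using that ij edge_label_eq_iff[OF R] by (intro sum.cong) auto
  have "(\<forall>e<length w. label_flow w ?E i j e = 0) \<longleftrightarrow> (\<forall>p\<in>{i..<j}. label_flow w ?E i j (?E p) = 0)"
  proof safe
    fix e assume *: "\<forall>p\<in>{i..<j}. label_flow w ?E i j (?E p) = 0"
    show "label_flow w ?E i j e = 0"
    proof (cases "e \<in> ?E ` {i..<j}")
      case False
      then show ?thesis unfolding label_flow_def by (intro sum.neutral) auto
    qed (use * in auto)
  next
    fix p assume "\<forall>e<length w. label_flow w ?E i j e = 0" "p \<in> {i..<j}"
    then show "label_flow w ?E i j (?E p) = 0" using ij edge_label_less by auto
  qed
  also have "\<dots> \<longleftrightarrow> (\<forall>e. flow r ?N w i j e = 0)"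
  proof (intro iffI allI ballI)
    fix e assume *: "\<forall>p\<in>{i..<j}. label_flow w ?E i j (?E p) = 0"
    show "flow r ?N w i j e = 0"
    proof (cases "e \<in> edge r ?N w ` {i..<j}")
      case False
      then show ?thesis unfolding flow_def by (intro sum.neutral) auto
    qed (use * eq in auto)
  next
    fix p assume "\<forall>e. flow r ?N w i j e = 0" "p \<in> {i..<j}"
    then show "label_flow w ?E i j (?E p) = 0" by (simp only: eq)
  qed
  also have "\<dots> \<longleftrightarrow> prefix_class r (Suc m) w i = prefix_class r (Suc m) w j"
    unfolding prefix_class_def using solv_proj_Suc_eq_iff[OF w ij] by simp
  finally show ?thesis .
qed

text \<open>The new label of \<open>i\<close> is the last prefix in its class at level
  \<open>Suc m\<close>, which is the same for all members of the class.\<close>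

lemma valid_labels_Suc:
  assumes R: "valid_labels r m w R" and w: "set w \<subseteq> letters r"
  shows "valid_labels r (Suc m) w (next_label w (edge_label w R))"
proof -
  let ?c = "prefix_class r (Suc m) w"
  have next_eq: "next_label w (edge_label w R) i = last_below (\<lambda>j. i \<le> j \<and> ?c i = ?c j) (Suc (length w))" for i
    unfolding next_label_def
    by (intro last_below_cong conj_cong refl label_flow_eq_0_iff[OF R w]) auto
  \<comment> \<open>From the larger index \<open>j\<close> on, the two search predicates coincide,
    and \<open>j\<close> itself is a hit.\<close>
  have "next_label w (edge_label w R) i = next_label w (edge_label w R) j"
    if "i \<le> j" "j \<le> length w" "?c i = ?c j" for i j
    unfolding next_eq by (rule last_below_le_imp_eq[of j]) (use that in auto)
  then have "next_label w (edge_label w R) i = next_label w (edge_label w R) j"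
    if "i \<le> length w" "j \<le> length w" "?c i = ?c j" for i j
    using that by (metis nat_le_linear)
  moreover have "next_label w (edge_label w R) i \<le> length w \<and> ?c (next_label w (edge_label w R) i) = ?c i"
    if "i \<le> length w" for i
    unfolding next_eq using last_below[of "\<lambda>j. i \<le> j \<and> ?c i = ?c j" i "Suc (length w)"] that by auto
  ultimately show ?thesis unfolding valid_labels_def by blast
qed

definition level_prog :: com where
  "level_prog = For 6 1 (Seq edge_label_prog next_label_prog)"

lemma runs_level_prog:
  assumes s: "ready d k w 0 s" "holds_labels 4 (Suc (length w)) (\<lambda>_. 0) s" and w: "set w \<subseteq> letters r"
  shows "runs level_prog s (d * (50 * Suc (length w) ^ 2 + 2) + 1)
    (\<lambda>s'. ready d k w d s' \<and> (\<exists>R. valid_labels r d w R \<and> holds_labels 4 (Suc (length w)) R s'))"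
proof -
  let ?n = "length w"
  let ?I = "\<lambda>m s. ready d k w m s \<and> (\<exists>R. valid_labels r m w R \<and> holds_labels 4 (Suc ?n) R s)"
  have body: "runs (Seq edge_label_prog next_label_prog) s (20 * Suc ?n ^ 2 + 30 * Suc ?n ^ 2)
      (\<lambda>s'. ?I (Suc m) (set_reg 6 (reg s' 6 + 1) s'))" if I: "?I m s" for m s
  proof -
    obtain R where R: "ready d k w m s" "valid_labels r m w R" "holds_labels 4 (Suc ?n) R s"
      using I by blast
    show ?thesis
    proof (rule runs_Seq[OF runs_edge_label_prog[OF R(1,3)]], rule runs_weaken[OF runs_next_label_prog])
      fix s' assume "ready d k w m s' \<and> holds_labels 4 (Suc ?n) (next_label w (edge_label w R)) s'"
      moreover have "ready d k w (Suc m) (set_reg 6 (reg s' 6 + 1) s')" if "ready d k w m s'"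
        using that by (simp add: ready_def)
      ultimately show "?I (Suc m) (set_reg 6 (reg s' 6 + 1) s')"
        using valid_labels_Suc[OF R(2) w] by auto
    qed (auto simp: edge_label_less)
  qed
  have "runs level_prog s ((d - 0) * (20 * Suc ?n ^ 2 + 30 * Suc ?n ^ 2 + 2) + 1) (?I d)"
    unfolding level_prog_def
    by (rule runs_For[where I = ?I]) (use s valid_labels_0[OF w] body readyD(1,7) in auto)
  then show ?thesis by (rule runs_weaken) (simp_all add: algebra_simps)
qed

section \<open>Collecting the terms of the derivative\<close>

definition fox_coeff :: "nat \<Rightarrow> letter list \<Rightarrow> (nat \<Rightarrow> nat) \<Rightarrow> nat \<Rightarrow> nat \<Rightarrow> int" where
  "fox_coeff k w R l i =
     (\<Sum>p<l. if R (edge_start w p) = i then if fst (w ! p) = k then letter_sign (w ! p) else 0 else 0)"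

definition fox_terms :: "nat \<Rightarrow> letter list \<Rightarrow> (nat \<Rightarrow> nat) \<Rightarrow> nat \<Rightarrow> (int \<times> nat) list" where
  "fox_terms k w R l =
     map (\<lambda>i. (fox_coeff k w R (length w) i, i)) (filter (\<lambda>i. fox_coeff k w R (length w) i \<noteq> 0) [0..<l])"

definition fox_coeff_body :: com where
  "fox_coeff_body = Seq (start_label_prog 11 7) (Seq (Load 12 0 7)
     (Cond (Equal 12 2)
       (Seq (Load 13 7 11) (Seq (Cond (Less 10 4) (Decr 13) (Incr 13)) (Store 7 11 13))) Nop))"

definition output_body :: com where
  "output_body = Seq (Load 11 7 7) (Cond (Equal 11 4) Nop (Seq (Store 2 0 11) (Seq (Store 3 0 7) (Incr 0))))"

definition output_prog :: com where
  "output_prog =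
     Seq (Seq (Const 7 0) (For 7 5 (Store 7 7 4)))
       (Seq (Seq (Const 7 0) (For 7 3 fox_coeff_body))
         (Seq (Seq (Const 0 0) (Const 7 0)) (For 7 5 output_body)))"

text \<open>Coefficients are accumulated in array 7 at the label of the start vertex. The bound on
  \<open>R\<close> keeps these indices within the stretch that is cleared before and scanned
  afterwards.\<close>

lemma runs_output_prog:
  assumes "ready d k w m s" "holds_labels 4 (Suc (length w)) R s"
    and R: "\<And>i. i \<le> length w \<Longrightarrow> R i \<le> length w"
  shows "runs output_prog s (40 * Suc (length w)) (\<lambda>s'. output_is s' (fox_terms k w R (Suc (length w))))"
proof -
  let ?n = "length w"
  let ?C = "\<lambda>l s. ready d k w m s \<and> holds_labels 4 (Suc ?n) R s \<and> reg s 7 = int l \<and> (\<forall>i<l. arr s 7 (int i) = 0)"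
  let ?S = "\<lambda>l s. ready d k w m s \<and> holds_labels 4 (Suc ?n) R s \<and> reg s 7 = int l \<and>
    (\<forall>i<Suc ?n. arr s 7 (int i) = fox_coeff k w R l i)"
  let ?O = "\<lambda>l s. ready d k w m s \<and> reg s 7 = int l \<and>
    (\<forall>i<Suc ?n. arr s 7 (int i) = fox_coeff k w R ?n i) \<and> output_is s (fox_terms k w R l)"
  have clear_body: "runs (Store 7 7 4) s 1 (\<lambda>s'. ?C (Suc l) (set_reg 7 (reg s' 7 + 1) s'))"
    if I: "?C l s" for l s
  proof -
    have r: "ready d k w m s" using I by simp
    show ?thesis by (rule straight_line_runs) (use I in \<open>auto simp: readyD[OF r] less_Suc_eq\<close>)
  qed
  have clear: "runs (Seq (Const 7 0) (For 7 5 (Store 7 7 4))) s (1 + ((Suc ?n - 0) * (1 + 2) + 1)) (?C (Suc ?n))"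
  proof (rule runs_Seq)
    show "runs (Const 7 0) s 1 (?C 0)"
      by (rule straight_line_runs) (use assms in auto)
    fix s' assume "?C 0 s'"
    then show "runs (For 7 5 (Store 7 7 4)) s' ((Suc ?n - 0) * (1 + 2) + 1) (?C (Suc ?n))"
      by (rule runs_For[where I = ?C]) (use clear_body readyD(6) in auto)
  qed
  have sum_body: "runs fox_coeff_body s 11 (\<lambda>s'. ?S (Suc p) (set_reg 7 (reg s' 7 + 1) s'))"
    if I: "?S p s" and p: "p < ?n" for p s
  proof -
    have r: "ready d k w m s" using I by simp
    have "effect (start_label_prog 11 7) s =
        set_reg 11 (int (R (edge_start w p))) (set_reg 10 (letter_sign (w ! p)) s)"
      using I p by (intro start_label_prog[OF r]) auto
    note effect = this readyD[OF r]
    have "arr s 7 (int (R (edge_start w p))) = fox_coeff k w R p (R (edge_start w p))"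
      using I R[OF edge_start_le[OF p]] by auto
    moreover have "fox_coeff k w R (Suc p) i = fox_coeff k w R p i +
        (if R (edge_start w p) = i then if fst (w ! p) = k then letter_sign (w ! p) else 0 else 0)" for i
      by (simp add: fox_coeff_def)
    ultimately show ?thesis
      by (intro straight_line_runs)
        (use I p in \<open>auto simp: fox_coeff_body_def effect letter_sign_def\<close>)
  qed
  have sum: "runs (Seq (Const 7 0) (For 7 3 fox_coeff_body)) s (1 + ((?n - 0) * (11 + 2) + 1)) (?S ?n)"
    if C: "?C (Suc ?n) s" for s
  proof (rule runs_Seq)
    show "runs (Const 7 0) s 1 (?S 0)"
      by (rule straight_line_runs) (use C in \<open>auto simp: fox_coeff_def\<close>)
    fix s' assume "?S 0 s'"
    then show "runs (For 7 3 fox_coeff_body) s' ((?n - 0) * (11 + 2) + 1) (?S ?n)"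
      by (rule runs_For[where I = ?S]) (use sum_body readyD(4) in auto)
  qed
  have out_frame: "output_is (set_reg x v s) ps = output_is s ps" if "x \<noteq> 0" for x v s ps
    using that by (simp add: output_is_def)
  have out_snoc: "output_is (set_reg 0 (reg s 0 + 1) (set_arr 3 (reg s 0) (int i) (set_arr 2 (reg s 0) c s))) (ps @ [(c, i)])"
    if "output_is s ps" for s ps c i
    using that by (auto simp: output_is_def nth_append less_Suc_eq)
  have out_body: "runs output_body s 5 (\<lambda>s'. ?O (Suc i) (set_reg 7 (reg s' 7 + 1) s'))"
    if I: "?O i s" and i: "i < Suc ?n" for i s
  proof -
    have r: "ready d k w m s" using I by simp
    let ?c = "fox_coeff k w R ?n i"
    let ?s = "set_reg 11 ?c s"
    have eff: "effect output_body s = (if ?c = 0 then ?s else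
        set_reg 0 (reg ?s 0 + 1) (set_arr 3 (reg ?s 0) (int i) (set_arr 2 (reg ?s 0) ?c ?s)))"
      using I i by (simp add: output_body_def readyD[OF r])
    have terms: "fox_terms k w R (Suc i) = fox_terms k w R i @ (if ?c = 0 then [] else [(?c, i)])"
      by (simp add: fox_terms_def)
    have "output_is ?s (fox_terms k w R i)" using I out_frame by simp
    then have "output_is (effect output_body s) (fox_terms k w R (Suc i))"
      unfolding eff terms using out_snoc[of ?s "fox_terms k w R i" i ?c] by (cases "?c = 0") simp_all
    then have Q: "?O (Suc i) (set_reg 7 (reg (effect output_body s) 7 + 1) (effect output_body s))"
      using I by (cases "?c = 0") (simp_all add: out_frame, simp_all add: eff)
    show ?thesis
    proof (rule straight_line_runs)
      show "straight_line output_body" "cost output_body \<le> 5" by (simp_all add: output_body_def)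
    qed (fact Q)
  qed
  have out: "runs (Seq (Seq (Const 0 0) (Const 7 0)) (For 7 5 output_body)) s (2 + ((Suc ?n - 0) * (5 + 2) + 1)) (?O (Suc ?n))"
    if S: "?S ?n s" for s
  proof (rule runs_Seq)
    show "runs (Seq (Const 0 0) (Const 7 0)) s 2 (?O 0)"
      by (rule straight_line_runs) (use S in \<open>auto simp: fox_terms_def output_is_def\<close>)
    fix s' assume "?O 0 s'"
    then show "runs (For 7 5 output_body) s' ((Suc ?n - 0) * (5 + 2) + 1) (?O (Suc ?n))"
      by (rule runs_For[where I = ?O]) (use out_body readyD(6) in auto)
  qed
  show ?thesis
    unfolding output_prog_def
    by (rule runs_weaken[OF runs_Seq[OF clear runs_Seq[OF sum out]]]) auto
qed

text \<open>A label with nonzero coefficient is the label of a start vertex and hence a fixed point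
  of \<open>R\<close>. Different fixed points lie in different classes, so the listed group elements
  are distinct.\<close>

lemma standard_presentation_fox_terms:
  assumes w: "set w \<subseteq> letters r" and R: "valid_labels r d w R"
  shows "standard_presentation (free_solvable_group r d) (solvable_fox_derivative r d k w)
    (map (\<lambda>(c, i). (c, solv_proj r d (reduce (take i w)))) (fox_terms k w R (Suc (length w))))"
proof -
  let ?n = "length w" and ?c = "fox_coeff k w R (length w)" and ?g = "prefix_class r d w"
  define I where "I = filter (\<lambda>i. ?c i \<noteq> 0) [0..<Suc ?n]"
  have set_I: "set I = {i. i \<le> ?n \<and> ?c i \<noteq> 0}" and distinct_I: "distinct I"
    by (auto simp: I_def simp del: upt_Suc)
  have ps: "map (\<lambda>(c, i). (c, solv_proj r d (reduce (take i w)))) (fox_terms k w R (Suc ?n)) =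
      map (\<lambda>i. (?c i, ?g i)) I"
    by (simp add: fox_terms_def prefix_class_def I_def del: upt_Suc)
  interpret N: normal "derived_term r d" "free_group r" by (rule normal_derived_term)
  have carrier: "?g i \<in> carrier (free_solvable_group r d)" for i
    using N.rcosetsI[OF N.subset reduce_take_in_carrier[OF w]]
    by (simp add: prefix_class_def solv_proj_def free_solvable_group_def FactGroup_def)
  have fixed: "i \<le> ?n \<and> R i = i" if nz: "?c i \<noteq> 0" for i
  proof -
    have "\<exists>p<?n. R (edge_start w p) = i"
    proof (rule ccontr)
      assume "\<not> ?thesis"
      then have "?c i = 0" unfolding fox_coeff_def by (intro sum.neutral) auto
      then show False using nz by simp
    qed
    then obtain p where p: "p < ?n" "R (edge_start w p) = i" by blast
    let ?v = "edge_start w p"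
    have "R ?v \<le> ?n" "?g (R ?v) = ?g ?v"
      using R edge_start_le[OF p(1)] unfolding valid_labels_def by blast+
    then have "R (R ?v) = R ?v"
      using valid_labels_eq_iff[OF R, of "R ?v" ?v] edge_start_le[OF p(1)] by simp
    then show ?thesis using \<open>R ?v \<le> ?n\<close> p(2) by simp
  qed
  have distinct: "distinct (map ?g I)"
    unfolding distinct_map
  proof
    show "inj_on ?g (set I)"
    proof (rule inj_onI)
      fix i j assume "i \<in> set I" "j \<in> set I" and eq: "?g i = ?g j"
      then have "i \<le> ?n" "R i = i" "j \<le> ?n" "R j = j" using fixed by (auto simp: set_I)
      then show "i = j" using valid_labels_eq_iff[OF R, of i j] eq by simp
    qed
  qed (rule distinct_I)
  have "solvable_fox_derivative r d k w x = (\<Sum>(c, g)\<leftarrow>map (\<lambda>i. (?c i, ?g i)) I. gr_scale c (gr_basis g) x)" for x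
  proof -
    have "(\<Sum>(c, g)\<leftarrow>map (\<lambda>i. (?c i, ?g i)) I. gr_scale c (gr_basis g) x) =
        (\<Sum>i\<leftarrow>I. if ?g i = x then ?c i else 0)"
      by (simp add: gr_scale_def gr_basis_def comp_def if_distrib eq_commute cong: if_cong)
    also have "\<dots> = (\<Sum>i\<in>set I. if ?g i = x then ?c i else 0)"
      by (rule sum_list_distinct_conv_sum_set[OF distinct_I])
    \<comment> \<open>The indices that the filter leaves out have coefficient 0.\<close>
    also have "\<dots> = (\<Sum>i\<le>?n. if ?g i = x then ?c i else 0)"
      by (intro sum.mono_neutral_left) (auto simp: set_I)
    also have "\<dots> = (\<Sum>i\<le>?n. \<Sum>p<?n. if R (edge_start w p) = i then
        if ?g i = x then if fst (w ! p) = k then letter_sign (w ! p) else 0 else 0 else 0)"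
    proof (rule sum.cong)
      fix i assume "i \<in> {..?n}"
      show "(if ?g i = x then ?c i else 0) = (\<Sum>p<?n. if R (edge_start w p) = i then
        if ?g i = x then if fst (w ! p) = k then letter_sign (w ! p) else 0 else 0 else 0)"
        by (cases "?g i = x") (simp_all add: fox_coeff_def cong: if_cong)
    qed simp
    also have "\<dots> = (\<Sum>p<?n. \<Sum>i\<le>?n. if R (edge_start w p) = i then
        if ?g i = x then if fst (w ! p) = k then letter_sign (w ! p) else 0 else 0 else 0)"
      by (rule sum.swap)
    \<comment> \<open>For each letter one index survives, the label of its start vertex, and it has
      the class of that vertex.\<close>
    also have "\<dots> = (\<Sum>p<?n. if ?g (edge_start w p) = x then if fst (w ! p) = k then letter_sign (w ! p) else 0 else 0)"
    proof (rule sum.cong)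
      fix p assume "p \<in> {..<?n}"
      then have "edge_start w p \<le> ?n" using edge_start_le by blast
      then have "R (edge_start w p) \<le> ?n" "?g (R (edge_start w p)) = ?g (edge_start w p)"
        using R unfolding valid_labels_def by blast+
      then show "(\<Sum>i\<le>?n. if R (edge_start w p) = i then
          if ?g i = x then if fst (w ! p) = k then letter_sign (w ! p) else 0 else 0 else 0) =
        (if ?g (edge_start w p) = x then if fst (w ! p) = k then letter_sign (w ! p) else 0 else 0)"
        by (simp add: sum.delta')
    qed simp
    also have "\<dots> = solvable_fox_derivative r d k w x"
      by (simp add: solvable_fox_derivative_eq_sum[OF w] prefix_class_def)
    finally show ?thesis by simp
  qed
  then show ?thesis
    unfolding standard_presentation_def ps using carrier distinct by (auto simp: comp_def set_I)
qed

section \<open>The whole program and its time bound\<close>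

definition fox_prog :: com where
  "fox_prog = Cond (Equal 3 4) (Const 0 0)
     (Seq (Seq (Copy 5 3) (Incr 5)) (Seq level_prog output_prog))"

lemma runs_fox_prog:
  assumes w: "set w \<subseteq> letters r" and "w \<noteq> []"
  shows "runs fox_prog (input_store r d k w)
    (1 + (2 + (d * (50 * Suc (length w) ^ 2 + 2) + 1 + 40 * Suc (length w)))) (output_presents_fox r d k w)"
proof -
  let ?n = "length w"
  \<comment> \<open>The input store is 0 in registers 4 and 6 and throughout array 4, so the
    constant 0, the level and the labels of level 0 are already in place.\<close>
  have init: "runs (Seq (Copy 5 3) (Incr 5)) (input_store r d k w) 2
      (\<lambda>s. ready d k w 0 s \<and> holds_labels 4 (Suc ?n) (\<lambda>_. 0) s)"
    by (rule straight_line_runs)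
      (auto simp: ready_def holds_labels_def input_store_def letter_sign_def)
  have "runs output_prog s (40 * Suc ?n) (output_presents_fox r d k w)"
    if final: "ready d k w d s \<and> (\<exists>R. valid_labels r d w R \<and> holds_labels 4 (Suc ?n) R s)" for s
  proof -
    obtain R where s: "ready d k w d s" "holds_labels 4 (Suc ?n) R s" and R: "valid_labels r d w R"
      using final by blast
    show ?thesis
    proof (rule runs_weaken[OF runs_output_prog[OF s]])
      show "R i \<le> ?n" if "i \<le> ?n" for i using R that unfolding valid_labels_def by blast
      fix s' assume "output_is s' (fox_terms k w R (Suc ?n))"
      moreover have "\<forall>(c, i)\<in>set (fox_terms k w R (Suc ?n)). i \<le> ?n" by (auto simp: fox_terms_def)
      ultimately show "output_presents_fox r d k w s'"
        unfolding output_presents_fox_def using standard_presentation_fox_terms[OF w R] by blast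
    qed simp
  qed
  with runs_level_prog[OF _ _ w]
  have "runs (Seq (Seq (Copy 5 3) (Incr 5)) (Seq level_prog output_prog)) (input_store r d k w)
      (2 + (d * (50 * Suc ?n ^ 2 + 2) + 1 + 40 * Suc ?n)) (output_presents_fox r d k w)"
    by (intro runs_Seq[OF init runs_Seq]) blast+
  then show ?thesis
    unfolding fox_prog_def
    by (intro runs_CondF) (simp_all add: input_store_def \<open>w \<noteq> []\<close>)
qed

text \<open>The empty word has a branch of its own: the general branch spends time on each of the
  \<open>d\<close> levels, whereas the final bound for length 0 is a constant.\<close>

lemma runs_fox_prog_Nil: "runs fox_prog (input_store r d k []) 2 (output_presents_fox r d k [])"
proof -
  have "standard_presentation (free_solvable_group r d) (solvable_fox_derivative r d k []) []"
    by (simp add: standard_presentation_def solvable_fox_derivative_eq_sum fun_eq_iff)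
  then have "output_presents_fox r d k [] s" if "reg s 0 = 0" for s
    unfolding output_presents_fox_def output_is_def using that by (intro exI[of _ "[]"]) simp
  then have "runs (Const 0 0) (input_store r d k []) 1 (output_presents_fox r d k [])"
    by (intro straight_line_runs) simp_all
  then have "runs fox_prog (input_store r d k []) (1 + 1) (output_presents_fox r d k [])"
    unfolding fox_prog_def by (intro runs_CondT) (simp_all add: input_store_def)
  then show ?thesis by (simp only: one_add_one)
qed

theorem lemma3p9:
  "\<exists>(prog :: com) (C :: nat). \<forall>(r :: nat) (d :: nat) (k :: nat) (w :: letter list).
     2 \<le> r \<and> 2 \<le> d \<and> set w \<subseteq> letters r \<and> k \<in> {1..r} \<longrightarrow>
     (\<exists>t s. exec prog (input_store r d k w) t s \<and>
            output_presents_fox r d k w s \<and>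
            t \<le> C * max 1 (d * r * length w ^ 3))"
proof (rule exI[of _ fox_prog], rule exI[of _ 300], intro allI impI, elim conjE)
  fix r d k :: nat and w :: "letter list"
  assume r: "2 \<le> r" and d: "2 \<le> d" and w: "set w \<subseteq> letters r"
  let ?n = "length w" and ?b = "300 * max 1 (d * r * length w ^ 3)"
  have "runs fox_prog (input_store r d k w) ?b (output_presents_fox r d k w)"
  proof (cases "w = []")
    case True
    then show ?thesis using runs_weaken[OF runs_fox_prog_Nil] by simp
  next
    case False
    have "Suc ?n \<le> 2 * ?n" using False by (cases w) auto
    have "?n * ?n \<ge> ?n" "?n * ?n * ?n \<ge> ?n * ?n" "1 \<le> ?n" using False by (cases w; simp)+
    have sq: "Suc ?n ^ 2 \<le> 4 * ?n ^ 3"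
    proof -
      have "Suc ?n ^ 2 \<le> (2 * ?n) ^ 2" using \<open>Suc ?n \<le> 2 * ?n\<close> by (rule power_mono) simp
      also have "\<dots> = 4 * (?n * ?n)" by (simp add: power2_eq_square)
      also have "\<dots> \<le> 4 * ?n ^ 3" using \<open>?n * ?n * ?n \<ge> ?n * ?n\<close> by (simp add: power3_eq_cube)
      finally show ?thesis .
    qed
    \<comment> \<open>All summands of the running time are compared with \<open>?x\<close>; the
      factor \<open>r\<close> enters only at the end.\<close>
    let ?x = "d * ?n ^ 3"
    have "1 \<le> ?n ^ 3" using \<open>1 \<le> ?n\<close> by simp
    have 1: "d \<le> ?x" using \<open>1 \<le> ?n ^ 3\<close> by simp
    have 2: "Suc ?n \<le> 2 * ?x"
    proof -
      have "?n \<le> ?n ^ 3" using \<open>?n * ?n \<ge> ?n\<close> \<open>?n * ?n * ?n \<ge> ?n * ?n\<close> by (simp add: power3_eq_cube)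
      also have "\<dots> \<le> ?x" using d by simp
      finally show ?thesis using \<open>Suc ?n \<le> 2 * ?n\<close> by simp
    qed
    have 3: "d * Suc ?n ^ 2 \<le> 4 * ?x" using mult_le_mono2[OF sq, of d] by simp
    have "1 + (2 + (d * (50 * Suc ?n ^ 2 + 2) + 1 + 40 * Suc ?n)) = 4 + 50 * (d * Suc ?n ^ 2) + 2 * d + 40 * Suc ?n"
      by (simp add: algebra_simps)
    \<comment> \<open>The summands are at most 4, 200 \<open>?x\<close>, 2 \<open>?x\<close> and 80
      \<open>?x\<close>, and the constant 4 fits into the remaining 18 \<open>?x\<close>.\<close>
    also have "\<dots> \<le> 300 * ?x"
    proof -
      have "4 + 50 * y + 2 * d + 40 * z \<le> 300 * x" if "d \<le> x" "z \<le> 2 * x" "y \<le> 4 * x" for x y z :: nat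
        using that d by linarith
      then show ?thesis using 1 2 3 .
    qed
    also have "\<dots> \<le> 300 * (d * r * ?n ^ 3)" using r by simp
    also have "\<dots> \<le> ?b" by simp
    finally show ?thesis by (intro runs_weaken[OF runs_fox_prog[OF w False]])
  qed
  then show "\<exists>t s. exec fox_prog (input_store r d k w) t s \<and> output_presents_fox r d k w s \<and> t \<le> ?b"
    unfolding runs_def by blast
qed

end
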